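(* The closure $\overline{\mathcal{H}}$ in $\mathrm{Aut}(T)$ of the Hanoi towers group $\mathcal{H}$ on 3 pegs is just-infinite.
   Context: $T$ is the ternary (3-regular) rooted tree with vertices the finite words over $\{1,2,3\}$; $\mathrm{Aut}(T)$ is the group of root- and adjacency-preserving bijections of $T$, acting on the left, a profinite group with the pointwise stabilizers of the levels as a base of neighborhoods of the identity. For $g\in\mathrm{Aut}(T)$ and a vertex $v$, the section $g|_v$ is defined by $g(vw)=g(v)\,g|_v(w)$. We write $g=(g_1,g_2,g_3)\tau$ if $g|_i=g_i$ for $i=1,2,3$ and $g$ acts on the first level as $\tau\in\mathrm{Sym}(3)$. The Hanoi towers group is $\mathcal{H}=\langle a,b,c\rangle\le\mathrm{Aut}(T)$, where $a=(a,1,1)(2,3)$, $b=(1,b,1)(1,3)$, $c=(1,1,c)(1,2)$ are defined recursively. An infinite topological group is just-infinite if every non-trivial closed normal subgroup has finite index. *)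

theory Defs
  imports
    "HOL-Algebra.Generated_Groups"
    "HOL-Analysis.Product_Topology"
    "HOL-Combinatorics.Transposition"
begin

section \<open>Just-infinite topological groups\<close>

definition topological_group :: "('a, 'b) monoid_scheme \<Rightarrow> 'a topology \<Rightarrow> bool" where
  "topological_group G X \<longleftrightarrow>
     group G \<and> topspace X = carrier G \<and>
     continuous_map (prod_topology X X) X (\<lambda>(x, y). x \<otimes>\<^bsub>G\<^esub> y) \<and>
     continuous_map X X (\<lambda>x. inv\<^bsub>G\<^esub> x)"

definition just_infinite :: "('a, 'b) monoid_scheme \<Rightarrow> 'a topology \<Rightarrow> bool" where
  "just_infinite G X \<longleftrightarrow>
     topological_group G X \<and> infinite (carrier G) \<and>
     (\<forall>N. N \<lhd> G \<and> closedin X N \<and> N \<noteq> {\<one>\<^bsub>G\<^esub>} \<longrightarrow> finite (rcosets\<^bsub>G\<^esub> N))"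


section \<open>The ternary rooted tree and its automorphism group\<close>

datatype letter = L1 | L2 | L3

type_synonym vertex = "letter list"

text \<open>The root is the empty word; the children of \<open>v\<close> are the words \<open>v @ [x]\<close>.\<close>

definition adjacent :: "vertex \<Rightarrow> vertex \<Rightarrow> bool" where
  "adjacent u v \<longleftrightarrow> (\<exists>x. v = u @ [x] \<or> u = v @ [x])"

definition tree_aut :: "(vertex \<Rightarrow> vertex) set" where
  "tree_aut = {g. bij g \<and> g [] = [] \<and> (\<forall>u v. adjacent (g u) (g v) \<longleftrightarrow> adjacent u v)}"

definition AutT :: "(vertex \<Rightarrow> vertex) monoid" where
  "AutT = \<lparr>carrier = tree_aut, mult = (\<circ>), one = id\<rparr>"

lemma AutT_simps [simp]:
  "carrier AutT = tree_aut" "g \<otimes>\<^bsub>AutT\<^esub> h = g \<circ> h" "\<one>\<^bsub>AutT\<^esub> = id"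
  by (simp_all add: AutT_def)

lemma tree_aut_comp: "g \<in> tree_aut \<Longrightarrow> h \<in> tree_aut \<Longrightarrow> g \<circ> h \<in> tree_aut"
  by (auto simp: tree_aut_def bij_comp)

lemma id_tree_aut: "id \<in> tree_aut"
  by (simp add: tree_aut_def)

lemma tree_aut_inv:
  assumes "g \<in> tree_aut" shows "inv_into UNIV g \<in> tree_aut"
proof -
  have b: "bij g" and r: "g [] = []"
    and adj: "\<And>u v. adjacent (g u) (g v) \<longleftrightarrow> adjacent u v"
    using assms by (auto simp: tree_aut_def)
  have 1: "g (inv_into UNIV g v) = v" for v
    using b by (simp add: bij_is_surj surj_f_inv_f)
  have 2: "inv_into UNIV g [] = []"
    using r b by (metis bij_inv_eq_iff)
  have "adjacent (inv_into UNIV g u) (inv_into UNIV g v) \<longleftrightarrow> adjacent u v" for u v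
    using adj[of "inv_into UNIV g u" "inv_into UNIV g v"] by (simp add: 1)
  with 2 show ?thesis
    using b by (simp add: tree_aut_def bij_imp_bij_inv)
qed

lemma group_AutT: "group AutT"
proof (rule groupI)
  fix g assume "g \<in> carrier AutT"
  then have "inv_into UNIV g \<in> carrier AutT" "inv_into UNIV g \<circ> g = id"
    using tree_aut_inv by (auto simp: tree_aut_def bij_is_inj)
  then show "\<exists>h\<in>carrier AutT. h \<otimes>\<^bsub>AutT\<^esub> g = \<one>\<^bsub>AutT\<^esub>"
    by auto
qed (auto simp: tree_aut_comp id_tree_aut comp_assoc)

lemma tree_aut_level:
  assumes "g \<in> tree_aut"
  shows "length (g v) = length v \<and> (v \<noteq> [] \<longrightarrow> butlast (g v) = g (butlast v))"
proof (induction v rule: length_induct)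
  case (1 v)
  have inj: "inj g" and root: "g [] = []"
    and adj: "\<And>u v. adjacent (g u) (g v) \<longleftrightarrow> adjacent u v"
    using assms by (auto simp: tree_aut_def bij_is_inj)
  show ?case
  proof (cases v rule: rev_cases)
    case Nil
    then show ?thesis by (simp add: root)
  next
    case (snoc u x)
    have lu: "length (g u) = length u"
      and bu: "u \<noteq> [] \<Longrightarrow> butlast (g u) = g (butlast u)"
      using 1 snoc by auto
    have "adjacent (g u) (g v)"
      using adj snoc by (auto simp: adjacent_def)
    then consider y where "g v = g u @ [y]" | y where "g u = g v @ [y]"
      by (auto simp: adjacent_def)
    then show ?thesis
    proof cases
      case 1
      then show ?thesis using lu snoc by simp
    next
      case 2
      then have "u \<noteq> []" using lu by auto
      then have "g v = g (butlast u)" using bu 2 by simp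
      then have "v = butlast u" using inj by (simp add: inj_eq)
      then have "length v = length u - 1" by simp
      then show ?thesis using snoc by simp
    qed
  qed
qed

lemma tree_aut_length: "g \<in> tree_aut \<Longrightarrow> length (g v) = length v"
  using tree_aut_level by blast

lemma tree_aut_append:
  assumes "g \<in> tree_aut" shows "\<exists>w'. length w' = length w \<and> g (v @ w) = g v @ w'"
proof (induction w rule: rev_induct)
  case Nil
  then show ?case by simp
next
  case (snoc x w)
  then obtain w' where w': "length w' = length w" "g (v @ w) = g v @ w'" by blast
  have ne: "g (v @ w @ [x]) \<noteq> []"
    using tree_aut_length[OF assms, of "v @ w @ [x]"] by auto
  have "butlast (g (v @ w @ [x])) = g (v @ w)"
    using tree_aut_level[OF assms, of "v @ w @ [x]"] by (simp add: butlast_append)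
  then have "g (v @ w @ [x]) = g v @ (w' @ [last (g (v @ w @ [x]))])"
    using append_butlast_last_id[OF ne] w'(2) by simp
  moreover have "length (w' @ [last (g (v @ w @ [x]))]) = length (w @ [x])"
    using w'(1) by simp
  ultimately show ?case by blast
qed


section \<open>Sections and wreath recursion\<close>

definition tree_section :: "(vertex \<Rightarrow> vertex) \<Rightarrow> vertex \<Rightarrow> (vertex \<Rightarrow> vertex)" where
  "tree_section g v = (\<lambda>w. drop (length (g v)) (g (v @ w)))"

lemma tree_section_eq:
  assumes "g \<in> tree_aut" shows "g (v @ w) = g v @ tree_section g v w"
  using tree_aut_append[OF assms, of w v] by (auto simp: tree_section_def)

text \<open>\<open>wreath_form g g1 g2 g3 \<tau>\<close> says that \<open>g = (g1, g2, g3) \<tau>\<close>.\<close>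

definition wreath_form ::
  "(vertex \<Rightarrow> vertex) \<Rightarrow> (vertex \<Rightarrow> vertex) \<Rightarrow> (vertex \<Rightarrow> vertex) \<Rightarrow> (vertex \<Rightarrow> vertex) \<Rightarrow>
   (letter \<Rightarrow> letter) \<Rightarrow> bool" where
  "wreath_form g g1 g2 g3 \<tau> \<longleftrightarrow>
     tree_section g [L1] = g1 \<and> tree_section g [L2] = g2 \<and> tree_section g [L3] = g3 \<and>
     (\<forall>x. g [x] = [\<tau> x])"


section \<open>The Hanoi towers group\<close>

primrec hanoi_a :: "vertex \<Rightarrow> vertex" where
  "hanoi_a [] = []"
| "hanoi_a (x # w) = Transposition.transpose L2 L3 x # (if x = L1 then hanoi_a w else w)"

primrec hanoi_b :: "vertex \<Rightarrow> vertex" where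
  "hanoi_b [] = []"
| "hanoi_b (x # w) = Transposition.transpose L1 L3 x # (if x = L2 then hanoi_b w else w)"

primrec hanoi_c :: "vertex \<Rightarrow> vertex" where
  "hanoi_c [] = []"
| "hanoi_c (x # w) = Transposition.transpose L1 L2 x # (if x = L3 then hanoi_c w else w)"

lemma wreath_form_hanoi:
  "wreath_form hanoi_a hanoi_a id id (Transposition.transpose L2 L3)"
  "wreath_form hanoi_b id hanoi_b id (Transposition.transpose L1 L3)"
  "wreath_form hanoi_c id id hanoi_c (Transposition.transpose L1 L2)"
  by (auto simp: wreath_form_def tree_section_def fun_eq_iff)

lemma involution_tree_aut:
  assumes inv: "\<And>v. g (g v) = v" and root: "g [] = []"
    and child: "\<And>v x. \<exists>y. g (v @ [x]) = g v @ [y]"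
  shows "g \<in> tree_aut"
proof -
  have *: "adjacent (g u) (g v)" if "adjacent u v" for u v
    using that child unfolding adjacent_def by metis
  have "adjacent (g u) (g v) \<longleftrightarrow> adjacent u v" for u v
    using *[of u v] *[of "g u" "g v"] by (auto simp: inv)
  moreover have "bij g"
    using inv by (intro involuntory_imp_bij)
  ultimately show ?thesis
    using root by (simp add: tree_aut_def)
qed

lemma hanoi_tree_aut: "hanoi_a \<in> tree_aut" "hanoi_b \<in> tree_aut" "hanoi_c \<in> tree_aut"
proof -
  have "hanoi_a (hanoi_a v) = v" for v
    by (induction v) (auto simp: Transposition.transpose_def)
  moreover have "\<exists>y. hanoi_a (v @ [x]) = hanoi_a v @ [y]" for v x
    by (induction v) auto
  ultimately show "hanoi_a \<in> tree_aut"
    by (intro involution_tree_aut) auto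
  have "hanoi_b (hanoi_b v) = v" for v
    by (induction v) (auto simp: Transposition.transpose_def)
  moreover have "\<exists>y. hanoi_b (v @ [x]) = hanoi_b v @ [y]" for v x
    by (induction v) auto
  ultimately show "hanoi_b \<in> tree_aut"
    by (intro involution_tree_aut) auto
  have "hanoi_c (hanoi_c v) = v" for v
    by (induction v) (auto simp: Transposition.transpose_def)
  moreover have "\<exists>y. hanoi_c (v @ [x]) = hanoi_c v @ [y]" for v x
    by (induction v) auto
  ultimately show "hanoi_c \<in> tree_aut"
    by (intro involution_tree_aut) auto
qed

lemma hanoi_unique:
  assumes g: "g \<in> tree_aut"
  shows "wreath_form g g id id (Transposition.transpose L2 L3) \<Longrightarrow> g = hanoi_a"
    and "wreath_form g id g id (Transposition.transpose L1 L3) \<Longrightarrow> g = hanoi_b"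
    and "wreath_form g id id g (Transposition.transpose L1 L2) \<Longrightarrow> g = hanoi_c"
proof -
  have root: "g [] = []" using g by (simp add: tree_aut_def)
  have step: "g (x # w) = g [x] @ tree_section g [x] w" for x w
    using tree_section_eq[OF g, of "[x]" w] by simp
  have "g w = hanoi_a w" if "wreath_form g g id id (Transposition.transpose L2 L3)" for w
  proof (induction w)
    case (Cons x w)
    then show ?case
      using that step[of x w] by (cases x) (simp_all add: wreath_form_def)
  qed (simp add: root)
  then show "wreath_form g g id id (Transposition.transpose L2 L3) \<Longrightarrow> g = hanoi_a"
    by blast
  have "g w = hanoi_b w" if "wreath_form g id g id (Transposition.transpose L1 L3)" for w
  proof (induction w)
    case (Cons x w)
    then show ?case
      using that step[of x w] by (cases x) (simp_all add: wreath_form_def)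
  qed (simp add: root)
  then show "wreath_form g id g id (Transposition.transpose L1 L3) \<Longrightarrow> g = hanoi_b"
    by blast
  have "g w = hanoi_c w" if "wreath_form g id id g (Transposition.transpose L1 L2)" for w
  proof (induction w)
    case (Cons x w)
    then show ?case
      using that step[of x w] by (cases x) (simp_all add: wreath_form_def)
  qed (simp add: root)
  then show "wreath_form g id id g (Transposition.transpose L1 L2) \<Longrightarrow> g = hanoi_c"
    by blast
qed

definition hanoi_group :: "(vertex \<Rightarrow> vertex) set" where
  "hanoi_group = generate AutT {hanoi_a, hanoi_b, hanoi_c}"


section \<open>The profinite topology on the automorphism group\<close>

definition level_stab :: "nat \<Rightarrow> (vertex \<Rightarrow> vertex) set" where
  "level_stab n = {g \<in> tree_aut. \<forall>v. length v = n \<longrightarrow> g v = v}"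

definition AutT_topology :: "(vertex \<Rightarrow> vertex) topology" where
  "AutT_topology =
     topology (\<lambda>U. U \<subseteq> tree_aut \<and> (\<forall>g\<in>U. \<exists>n. g <#\<^bsub>AutT\<^esub> level_stab n \<subseteq> U))"

lemma level_stab_antimono:
  assumes "m \<le> n" shows "level_stab n \<subseteq> level_stab m"
proof
  fix g assume "g \<in> level_stab n"
  then have g: "g \<in> tree_aut" and fixed: "\<And>v. length v = n \<Longrightarrow> g v = v"
    by (auto simp: level_stab_def)
  have "g v = v" if "length v = m" for v
  proof -
    define w where "w = replicate (n - m) L1"
    have "g (v @ w) = v @ w"
      using that assms by (intro fixed) (simp add: w_def)
    then have "g v @ tree_section g v w = v @ w"
      using tree_section_eq[OF g, of v w] by simp
    then show ?thesis
      using tree_aut_length[OF g, of v] by (simp add: append_eq_append_conv)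
  qed
  with g show "g \<in> level_stab m" by (simp add: level_stab_def)
qed

lemma openin_AutT_topology:
  "openin AutT_topology U \<longleftrightarrow>
     U \<subseteq> tree_aut \<and> (\<forall>g\<in>U. \<exists>n. g <#\<^bsub>AutT\<^esub> level_stab n \<subseteq> U)"
proof -
  have mono: "g <#\<^bsub>AutT\<^esub> level_stab n \<subseteq> g <#\<^bsub>AutT\<^esub> level_stab m" if "m \<le> n" for g m n
    using level_stab_antimono[OF that] by (auto simp: l_coset_def)
  have "istopology (\<lambda>U. U \<subseteq> tree_aut \<and> (\<forall>g\<in>U. \<exists>n. g <#\<^bsub>AutT\<^esub> level_stab n \<subseteq> U))"
    unfolding istopology_def
  proof (rule conjI; intro allI impI conjI ballI)
    fix S T g
    assume S: "S \<subseteq> tree_aut \<and> (\<forall>g\<in>S. \<exists>n. g <#\<^bsub>AutT\<^esub> level_stab n \<subseteq> S)"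
      and T: "T \<subseteq> tree_aut \<and> (\<forall>g\<in>T. \<exists>n. g <#\<^bsub>AutT\<^esub> level_stab n \<subseteq> T)"
      and g: "g \<in> S \<inter> T"
    obtain m n where "g <#\<^bsub>AutT\<^esub> level_stab m \<subseteq> S" "g <#\<^bsub>AutT\<^esub> level_stab n \<subseteq> T"
      using S T g by blast
    then have "g <#\<^bsub>AutT\<^esub> level_stab (max m n) \<subseteq> S \<inter> T"
      using mono[of m "max m n" g] mono[of n "max m n" g] by auto
    then show "\<exists>n. g <#\<^bsub>AutT\<^esub> level_stab n \<subseteq> S \<inter> T" by blast
  next
    fix \<K> g
    assume K: "\<forall>K\<in>\<K>. K \<subseteq> tree_aut \<and> (\<forall>g\<in>K. \<exists>n. g <#\<^bsub>AutT\<^esub> level_stab n \<subseteq> K)"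
      and "g \<in> \<Union>\<K>"
    then obtain K n where "K \<in> \<K>" "g <#\<^bsub>AutT\<^esub> level_stab n \<subseteq> K" by blast
    then show "\<exists>n. g <#\<^bsub>AutT\<^esub> level_stab n \<subseteq> \<Union>\<K>" by blast
  qed blast+
  then show ?thesis
    by (simp add: AutT_topology_def topology_inverse')
qed

lemma topspace_AutT_topology: "topspace AutT_topology = tree_aut"
proof (rule subset_antisym)
  show "topspace AutT_topology \<subseteq> tree_aut"
    using openin_topspace[of AutT_topology] openin_AutT_topology[of "topspace AutT_topology"]
    by blast
  have "openin AutT_topology tree_aut"
    by (auto simp: openin_AutT_topology l_coset_def level_stab_def tree_aut_comp)
  then show "tree_aut \<subseteq> topspace AutT_topology"
    by (rule openin_subset)
qed

lemma openin_level_stab: "openin AutT_topology (level_stab n)"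
proof -
  have "g <#\<^bsub>AutT\<^esub> level_stab n \<subseteq> level_stab n" if "g \<in> level_stab n" for g
    using that by (auto simp: l_coset_def level_stab_def tree_aut_comp)
  then show ?thesis
    unfolding openin_AutT_topology by (auto simp: level_stab_def)
qed

definition hanoi_closure :: "(vertex \<Rightarrow> vertex) set" where
  "hanoi_closure = AutT_topology closure_of hanoi_group"

end

theory Submission
  imports Defs "HOL-Combinatorics.Permutations"
begin

text \<open>
  The closure of the Hanoi towers group is the group \<open>P\<close> of all automorphisms such that at every vertex
  the sign of the local permutation is the product of the signs at its three children. Let \<open>K\<close> be
  the kernel in \<open>P\<close> of the sign at the root. Every set of automorphisms closed under products and
  under conjugation by the generators \<open>x\<close>, and containing all \<open>(xy)\<^sup>2\<close>, has \<open>K\<close> in its closure: the hypothesis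
  passes from \<open>Q\<close> to the set of \<open>k\<close> with \<open>(k, 1, 1) \<in> Q\<close>, because \<open>(acbc)\<^sup>2 = ((ab)\<^sup>2, 1, 1)\<close>, so
  one can approximate level by level.

  If \<open>N\<close> is a closed normal subgroup and \<open>g \<in> N\<close> moves the vertex \<open>v\<close>, then commuting twice with
  elements supported below \<open>v\<close> puts all \<open>[k, l]\<close> with \<open>k, l \<in> K\<close>, placed at \<open>v\<close>, into \<open>N\<close>. Choosing
  \<open>k = (x, x\<inverse>, 1)\<close> and \<open>l = (y, 1, y\<inverse>)\<close> gives \<open>([x, y], 1, 1)\<close> for arbitrary \<open>x, y \<in> P\<close>. By density
  and level transitivity \<open>N\<close> contains a copy of \<open>K\<close> at every vertex one level below \<open>v\<close>, hence a level
  stabilizer of \<open>P\<close>, and so has finite index.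
\<close>

section \<open>Tree automorphisms and the wreath recursion\<close>

lemma UNIV_letter: "(UNIV :: letter set) = {L1, L2, L3}"
  using letter.exhaust by auto

lemma finite_letter [simp]: "finite (A :: letter set)"
  by (rule finite_subset[OF subset_UNIV]) (simp add: UNIV_letter)

lemma distinct_letters_UNIV:
  fixes x y z :: letter
  assumes "x \<noteq> y" "x \<noteq> z" "y \<noteq> z"
  shows "UNIV = {x, y, z}"
  using assms by (cases x; cases y; cases z) (auto simp: UNIV_letter)

lemma sign_letter_comp:
  fixes p q :: "letter \<Rightarrow> letter"
  assumes "bij p" "bij q"
  shows "sign (p \<circ> q) = sign p * sign q"
  using assms by (intro sign_compose) (auto simp: permutation)

text \<open>Otherwise \<open>p\<close> would swap the two letters other than \<open>x\<close>, hence
  be a transposition, of sign -1.\<close>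

lemma sign_letter_fixed_point:
  fixes p :: "letter \<Rightarrow> letter"
  assumes "bij p" "sign p = 1" "p x = x"
  shows "p = id"
proof (rule ccontr)
  assume "p \<noteq> id"
  then obtain y where y: "p y \<noteq> y" by (auto simp: fun_eq_iff)
  define z where "z = p y"
  have inj: "inj p" using assms(1) by (simp add: bij_is_inj)
  have d: "x \<noteq> y" "x \<noteq> z" "y \<noteq> z"
    using y assms(3) inj unfolding z_def inj_def by metis+
  have "p z = y"
    using distinct_letters_UNIV[OF d] inj d assms(3) unfolding z_def inj_def
    by (metis UNIV_I empty_iff insert_iff)
  then have "p w = Transposition.transpose y z w" for w
    using distinct_letters_UNIV[OF d] d assms(3) z_def
    by (cases "w = x"; cases "w = y"; cases "w = z") auto
  then have "p = Transposition.transpose y z" by blast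
  with d assms(2) show False by (simp add: sign_swap_id)
qed

section \<open>Wreath recursion and inverses of tree automorphisms\<close>

definition wreath :: "(letter \<Rightarrow> letter) \<Rightarrow> (letter \<Rightarrow> vertex \<Rightarrow> vertex) \<Rightarrow> vertex \<Rightarrow> vertex" where
  "wreath \<tau> f w = (case w of [] \<Rightarrow> [] | x # u \<Rightarrow> \<tau> x # f x u)"

lemma wreath_simps [simp]: "wreath \<tau> f [] = []" "wreath \<tau> f (x # u) = \<tau> x # f x u"
  by (simp_all add: wreath_def)

lemma wreath_comp: "wreath \<tau> f \<circ> wreath \<sigma> h = wreath (\<tau> \<circ> \<sigma>) (\<lambda>x. f (\<sigma> x) \<circ> h x)"
  by (auto simp: fun_eq_iff wreath_def split: list.splits)

lemma wreath_id_comp: "wreath id f \<circ> wreath id h = wreath id (\<lambda>x. f x \<circ> h x)"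
  by (simp add: wreath_comp)

lemma wreath_id: "wreath id (\<lambda>_. id) = id"
  by (auto simp: fun_eq_iff wreath_def split: list.splits)

lemma wreath_cong: "\<tau> = \<sigma> \<Longrightarrow> (\<And>x. f x = h x) \<Longrightarrow> wreath \<tau> f = wreath \<sigma> h"
  by (simp add: wreath_def fun_eq_iff split: list.split)

abbreviation ginv :: "(vertex \<Rightarrow> vertex) \<Rightarrow> vertex \<Rightarrow> vertex" where
  "ginv g \<equiv> inv_into UNIV g"

lemma tree_aut_bij: "g \<in> tree_aut \<Longrightarrow> bij g"
  by (simp add: tree_aut_def)

lemma tree_aut_Nil: "g \<in> tree_aut \<Longrightarrow> g [] = []"
  by (simp add: tree_aut_def)

lemma tree_aut_eq_iff: "g \<in> tree_aut \<Longrightarrow> g u = g v \<longleftrightarrow> u = v"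
  by (metis tree_aut_bij bij_is_inj injD)

lemma tree_aut_ginv_apply:
  assumes "g \<in> tree_aut"
  shows "g (ginv g v) = v" "ginv g (g v) = v"
  using tree_aut_bij[OF assms] by (simp_all add: bij_is_surj surj_f_inv_f bij_is_inj inv_f_f)

lemma tree_aut_ginv [simp]:
  assumes "g \<in> tree_aut"
  shows "g \<circ> ginv g = id" "ginv g \<circ> g = id"
  using assms by (simp_all add: fun_eq_iff tree_aut_ginv_apply)

lemma ginv_unique:
  assumes "g \<in> tree_aut" "h \<circ> g = id"
  shows "ginv g = h"
  by (metis assms comp_assoc comp_id id_comp tree_aut_ginv(1))

lemma ginv_comp: "g \<in> tree_aut \<Longrightarrow> h \<in> tree_aut \<Longrightarrow> ginv (g \<circ> h) = ginv h \<circ> ginv g"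
  by (simp add: tree_aut_bij o_inv_distrib)

lemma ginv_ginv: "g \<in> tree_aut \<Longrightarrow> ginv (ginv g) = g"
  by (simp add: tree_aut_bij inv_inv_eq)

text \<open>Sending children to children is enough: if \<open>g v\<close> is a child of
  \<open>g u\<close>, then it is also a child of the image of the parent of \<open>v\<close>, and
  injectivity makes that parent equal to \<open>u\<close>.\<close>

lemma tree_autI:
  assumes "bij g" "g [] = []" "\<And>v x. \<exists>y. g (v @ [x]) = g v @ [y]"
  shows "g \<in> tree_aut"
proof -
  have inj: "g u = g v \<longleftrightarrow> u = v" for u v
    using assms(1) by (meson bij_is_inj injD)
  have *: "(\<exists>y. g v = g u @ [y]) \<longleftrightarrow> (\<exists>x. v = u @ [x])" for u v
  proof
    assume y: "\<exists>y. g v = g u @ [y]"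
    then have "v \<noteq> []" using assms(2) by auto
    then obtain v' x where v: "v = v' @ [x]" by (metis rev_exhaust)
    with y assms(3)[of v' x] have "g v' = g u" by auto
    with v inj show "\<exists>x. v = u @ [x]" by simp
  qed (use assms(3) in auto)
  then show ?thesis
    using assms(1,2) unfolding tree_aut_def adjacent_def by blast
qed

lemma wreath_tree_aut:
  assumes "bij \<tau>" "\<And>x. f x \<in> tree_aut"
  shows "wreath \<tau> f \<in> tree_aut"
proof (rule tree_autI)
  \<comment> \<open>The inverse is explicit: \<open>\<sigma>\<close> on the first letter, and below
    \<open>x\<close> the inverse of the section at the letter \<open>\<sigma> x\<close> that
    \<open>\<tau>\<close> sends to \<open>x\<close>.\<close>
  define \<sigma> where "\<sigma> = inv_into UNIV \<tau>"
  have \<sigma>: "\<tau> \<circ> \<sigma> = id" "\<sigma> \<circ> \<tau> = id" "\<And>x. \<sigma> (\<tau> x) = x"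
    using assms(1) by (auto simp: \<sigma>_def fun_eq_iff bij_is_inj bij_is_surj surj_f_inv_f)
  have "wreath \<tau> f \<circ> wreath \<sigma> (\<lambda>x. ginv (f (\<sigma> x))) = id"
    "wreath \<sigma> (\<lambda>x. ginv (f (\<sigma> x))) \<circ> wreath \<tau> f = id"
    using assms(2) by (simp_all add: wreath_comp \<sigma> wreath_id)
  then show "bij (wreath \<tau> f)"
    by (rule o_bij[rotated])
  show "\<exists>y. wreath \<tau> f (v @ [x]) = wreath \<tau> f v @ [y]" for v x
  proof (cases v)
    case Nil
    then show ?thesis using assms(2) by (simp add: tree_aut_Nil)
  next
    case (Cons a u)
    have "length (f a (u @ [x])) = Suc (length u)" "f a (u @ [x]) = f a u @ tree_section (f a) u [x]"
      using assms(2)[of a] tree_aut_length tree_section_eq by auto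
    moreover have "length (f a u) = length u" using assms(2) tree_aut_length by blast
    ultimately show ?thesis using Cons
      by (auto simp: length_Suc_conv)
  qed
qed simp

section \<open>Sections of tree automorphisms\<close>

lemma section_tree_aut:
  assumes "g \<in> tree_aut" shows "tree_section g v \<in> tree_aut"
proof (rule tree_autI)
  note eq = tree_section_eq[OF assms] 
  have len: "length (tree_section g v w) = length w" for w
    using eq[of v w] tree_aut_length[OF assms, of "v @ w"] tree_aut_length[OF assms, of v] by simp
  show "tree_section g v [] = []"
    using len[of "[]"] by simp
  have "inj (tree_section g v)"
  proof (rule injI)
    fix u w assume "tree_section g v u = tree_section g v w"
    then have "g (v @ u) = g (v @ w)" by (simp add: eq)
    then show "u = w" using tree_aut_eq_iff[OF assms] by simp
  qed
  moreover have "\<exists>u. w = tree_section g v u" for w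
  proof -
    \<comment> \<open>Surjectivity: the preimage of \<open>g v @ w\<close> has a prefix of length
      \<open>length v\<close> that is mapped to \<open>g v\<close>. This prefix is therefore
      \<open>v\<close>, and the rest of the word is the preimage of \<open>w\<close> under the
      section.\<close>
    define u where "u = ginv g (g v @ w)"
    have g: "g u = g v @ w" using assms by (simp add: u_def tree_aut_ginv_apply)
    then have "length u \<ge> length v" 
      using tree_aut_length[OF assms, of u] tree_aut_length[OF assms, of v] by simp
    then have l: "length (take (length v) u) = length v" by simp
    have "g (take (length v) u) @ tree_section g (take (length v) u) (drop (length v) u) = g v @ w"
      using tree_section_eq[OF assms, of "take (length v) u" "drop (length v) u"] g by simp
    then have "g (take (length v) u) = g v"
      using l tree_aut_length[OF assms] by (simp add: append_eq_append_conv)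
    then have "take (length v) u = v" using tree_aut_eq_iff[OF assms] by simp
    then have "u = v @ drop (length v) u" by (metis append_take_drop_id)
    then have "w = tree_section g v (drop (length v) u)"
      using eq[of v "drop (length v) u"] g by simp
    then show ?thesis by blast
  qed
  ultimately show "bij (tree_section g v)"
    by (auto simp: bij_def surj_def)
  show "\<exists>y. tree_section g v (w @ [x]) = tree_section g v w @ [y]" for w x
  proof -
    have "g v @ tree_section g v (w @ [x]) = g v @ tree_section g v w @ tree_section g (v @ w) [x]"
      using eq[of v "w @ [x]"] eq[of v w] eq[of "v @ w" "[x]"] by simp
    then have "tree_section g v (w @ [x]) = tree_section g v w @ tree_section g (v @ w) [x]" by simp
    with len[of "w @ [x]"] len[of w] show ?thesis
      by (auto simp: length_Suc_conv)
  qed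
qed

lemma section_append:
  assumes "g \<in> tree_aut"
  shows "tree_section (tree_section g u) v = tree_section g (u @ v)"
proof
  fix w
  have "g u @ tree_section g u v @ tree_section (tree_section g u) v w = g u @ tree_section g u (v @ w)"
    using tree_section_eq[OF section_tree_aut[OF assms]] by simp
  also have "\<dots> = g (u @ v) @ tree_section g (u @ v) w"
    using tree_section_eq[OF assms, of u "v @ w"] tree_section_eq[OF assms, of "u @ v" w] by simp
  also have "\<dots> = g u @ tree_section g u v @ tree_section g (u @ v) w"
    using tree_section_eq[OF assms, of u v] by simp
  finally show "tree_section (tree_section g u) v w = tree_section g (u @ v) w" by simp
qed

lemma section_comp:
  assumes "g \<in> tree_aut" "h \<in> tree_aut"
  shows "tree_section (g \<circ> h) v = tree_section g (h v) \<circ> tree_section h v"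
proof
  fix w
  show "tree_section (g \<circ> h) v w = (tree_section g (h v) \<circ> tree_section h v) w"
    using tree_section_eq[OF assms(2), of v w] tree_section_eq[OF assms(1), of "h v"]
      tree_section_eq[OF tree_aut_comp[OF assms], of v w] by simp
qed

lemma section_Nil [simp]: "g \<in> tree_aut \<Longrightarrow> tree_section g [] = g"
  by (simp add: tree_section_def tree_aut_Nil)

lemma section_id [simp]: "tree_section id v = id"
  by (auto simp: tree_section_def fun_eq_iff)

lemma section_ginv:
  assumes "g \<in> tree_aut"
  shows "tree_section (ginv g) v = ginv (tree_section g (ginv g v))"
proof -
  have "tree_section g (ginv g v) \<circ> tree_section (ginv g) v = id"
    using section_comp[OF assms tree_aut_inv[OF assms], of v] assms by simp
  then have "ginv (tree_section (ginv g) v) = tree_section g (ginv g v)"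
    by (intro ginv_unique section_tree_aut tree_aut_inv assms)
  then show ?thesis
    by (metis assms ginv_ginv section_tree_aut tree_aut_inv)
qed

lemma section_wreath:
  assumes "\<And>x. f x \<in> tree_aut"
  shows "tree_section (wreath \<tau> f) (x # v) = tree_section (f x) v"
  by (auto simp: tree_section_def fun_eq_iff)

section \<open>Action on the first level\<close>

definition root_perm :: "(vertex \<Rightarrow> vertex) \<Rightarrow> letter \<Rightarrow> letter" where
  "root_perm g x = hd (g [x])"

lemma tree_aut_singleton:
  assumes "g \<in> tree_aut" shows "g [x] = [root_perm g x]"
  using tree_aut_length[OF assms, of "[x]"] by (auto simp: root_perm_def length_Suc_conv)

lemma root_perm_wreath [simp]: "root_perm (wreath \<tau> f) = \<tau>"
  by (simp add: root_perm_def fun_eq_iff)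

lemma root_perm_comp:
  assumes "g \<in> tree_aut" "h \<in> tree_aut"
  shows "root_perm (g \<circ> h) = root_perm g \<circ> root_perm h"
proof
  fix x
  show "root_perm (g \<circ> h) x = (root_perm g \<circ> root_perm h) x"
    unfolding root_perm_def[of "g \<circ> h"] using assms by (simp add: tree_aut_singleton)
qed

lemma root_perm_id [simp]: "root_perm id = id"
  by (simp add: root_perm_def fun_eq_iff)

lemma root_perm_bij:
  assumes "g \<in> tree_aut" shows "bij (root_perm g)"
proof (rule o_bij)
  show "root_perm (ginv g) \<circ> root_perm g = id" "root_perm g \<circ> root_perm (ginv g) = id"
    using assms by (simp_all flip: root_perm_comp add: tree_aut_inv)
qed

lemma wreath_decomp:
  assumes "g \<in> tree_aut"
  shows "g = wreath (root_perm g) (\<lambda>x. tree_section g [x])"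
proof
  fix w
  show "g w = wreath (root_perm g) (\<lambda>x. tree_section g [x]) w"
  proof (cases w)
    case (Cons x u)
    then show ?thesis
      using tree_section_eq[OF assms, of "[x]" u] tree_aut_singleton[OF assms, of x] by simp
  qed (simp add: assms tree_aut_Nil)
qed


section \<open>Parity-constrained automorphisms and the Hanoi generators\<close>

definition root_sign :: "(vertex \<Rightarrow> vertex) \<Rightarrow> int" where
  "root_sign g = sign (root_perm g)"

definition parity_auts :: "(vertex \<Rightarrow> vertex) set" where
  "parity_auts = {g \<in> tree_aut. \<forall>v.
     root_sign (tree_section g v) = (\<Prod>x\<in>UNIV. root_sign (tree_section g (v @ [x])))}"

lemma root_sign_comp:
  "g \<in> tree_aut \<Longrightarrow> h \<in> tree_aut \<Longrightarrow> root_sign (g \<circ> h) = root_sign g * root_sign h"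
  by (simp add: root_sign_def root_perm_comp sign_letter_comp root_perm_bij)

lemma root_sign_id [simp]: "root_sign id = 1"
  by (simp add: root_sign_def)

lemma root_sign_wreath [simp]: "root_sign (wreath \<tau> f) = sign \<tau>"
  by (simp add: root_sign_def)

lemma root_sign_cases: "root_sign g = 1 \<or> root_sign g = - 1"
  by (metis root_sign_def sign_cases)

lemma root_sign_ginv:
  assumes "g \<in> tree_aut" shows "root_sign (ginv g) = root_sign g"
  using root_sign_comp[OF assms tree_aut_inv[OF assms]] root_sign_cases[of g]
    root_sign_cases[of "ginv g"] assms by auto

lemma parity_tree_aut: "g \<in> parity_auts \<Longrightarrow> g \<in> tree_aut"
  by (simp add: parity_auts_def)

text \<open>Iterating first-level sections never leaves \<open>X\<close>, so the condition at an
  arbitrary vertex is the root condition for a member of \<open>X\<close>. Closure properties of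
  \<open>parity_auts\<close> thus only need to be checked at the root.\<close>

lemma parity_coinduct:
  assumes "g \<in> X" "X \<subseteq> tree_aut" "\<And>g x. g \<in> X \<Longrightarrow> tree_section g [x] \<in> X"
    and root: "\<And>g. g \<in> X \<Longrightarrow> root_sign g = (\<Prod>x\<in>UNIV. root_sign (tree_section g [x]))"
  shows "g \<in> parity_auts"
proof -
  have sec: "tree_section g v \<in> X" for v
  proof (induction v rule: rev_induct)
    case Nil
    then show ?case using assms(1,2) by auto
  next
    case (snoc x v)
    then show ?case
      using assms(3)[of "tree_section g v" x] section_append assms(1,2) by (metis subsetD)
  qed
  have g: "g \<in> tree_aut" using assms(1,2) by blast
  show ?thesis
    unfolding parity_auts_def mem_Collect_eq
  proof (intro conjI allI g)
    show "root_sign (tree_section g v) = (\<Prod>x\<in>UNIV. root_sign (tree_section g (v @ [x])))" for v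
      using root[OF sec, of v] unfolding section_append[OF g] .
  qed
qed

lemma parity_section:
  assumes "g \<in> parity_auts" shows "tree_section g v \<in> parity_auts"
proof -
  have g: "g \<in> tree_aut" using assms by (rule parity_tree_aut)
  have eq: "root_sign (tree_section g w) = (\<Prod>x\<in>UNIV. root_sign (tree_section g (w @ [x])))" for w
    using assms unfolding parity_auts_def by blast
  show ?thesis
    unfolding parity_auts_def mem_Collect_eq section_append[OF g] append_assoc[symmetric]
    using section_tree_aut[OF g] eq by blast
qed

lemma parity_root:
  assumes "g \<in> parity_auts"
  shows "root_sign g = (\<Prod>x\<in>UNIV. root_sign (tree_section g [x]))"
proof -
  have "root_sign (tree_section g []) = (\<Prod>x\<in>UNIV. root_sign (tree_section g ([] @ [x])))"
    using assms unfolding parity_auts_def by blast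
  then show ?thesis using assms by (simp add: parity_tree_aut)
qed

lemma parity_id: "id \<in> parity_auts"
  by (rule parity_coinduct[of _ "{id}"]) (auto simp: id_tree_aut)

lemma parity_comp:
  assumes "g \<in> parity_auts" "h \<in> parity_auts" shows "g \<circ> h \<in> parity_auts"
proof (rule parity_coinduct)
  let ?X = "{g \<circ> h |g h. g \<in> parity_auts \<and> h \<in> parity_auts}"
  show "g \<circ> h \<in> ?X" using assms by blast
  show "?X \<subseteq> tree_aut" by (auto simp: parity_tree_aut tree_aut_comp)
  show "tree_section k [x] \<in> ?X" if "k \<in> ?X" for k x
    using that by (force simp: section_comp parity_tree_aut intro: parity_section)
  show "root_sign k = (\<Prod>x\<in>UNIV. root_sign (tree_section k [x]))" if "k \<in> ?X" for k
  proof -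
    from that obtain g h where k: "k = g \<circ> h" and gh: "g \<in> parity_auts" "h \<in> parity_auts"
      by blast
    note t = gh[THEN parity_tree_aut]
    have "(\<Prod>x\<in>UNIV. root_sign (tree_section (g \<circ> h) [x]))
        = (\<Prod>x\<in>UNIV. root_sign (tree_section g [root_perm h x])) * (\<Prod>x\<in>UNIV. root_sign (tree_section h [x]))"
      using t by (simp add: section_comp root_sign_comp section_tree_aut tree_aut_singleton prod.distrib)
    \<comment> \<open>Composing with \<open>h\<close> only permutes the first-level sections of
      \<open>g\<close>, which does not affect the product of their signs.\<close>
    also have "(\<Prod>x\<in>UNIV. root_sign (tree_section g [root_perm h x])) = (\<Prod>x\<in>UNIV. root_sign (tree_section g [x]))"
      by (rule prod.reindex_bij_betw) (rule root_perm_bij[OF t(2)])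
    finally show ?thesis
      unfolding k root_sign_comp[OF t] parity_root[OF gh(1)] parity_root[OF gh(2)] by (rule sym)
  qed
qed

lemma parity_ginv:
  assumes "g \<in> parity_auts" shows "ginv g \<in> parity_auts"
proof (rule parity_coinduct)
  let ?X = "ginv ` parity_auts"
  show "ginv g \<in> ?X" using assms by blast
  show "?X \<subseteq> tree_aut" by (auto simp: parity_tree_aut tree_aut_inv)
  show "tree_section k [x] \<in> ?X" if "k \<in> ?X" for k x
    using that by (force simp: section_ginv parity_tree_aut intro: parity_section)
  show "root_sign k = (\<Prod>x\<in>UNIV. root_sign (tree_section k [x]))" if "k \<in> ?X" for k
  proof -
    from that obtain g where k: "k = ginv g" and g: "g \<in> parity_auts"
      by blast
    note t = parity_tree_aut[OF g]
    have "(\<Prod>x\<in>UNIV. root_sign (tree_section k [x]))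
        = (\<Prod>x\<in>UNIV. root_sign (tree_section g [root_perm (ginv g) x]))"
      using t by (simp add: k section_ginv root_sign_ginv section_tree_aut tree_aut_singleton tree_aut_inv)
    also have "\<dots> = (\<Prod>x\<in>UNIV. root_sign (tree_section g [x]))"
      by (rule prod.reindex_bij_betw) (rule root_perm_bij[OF tree_aut_inv[OF t]])
    finally show ?thesis
      using parity_root[OF g] t by (simp add: k root_sign_ginv)
  qed
qed

text \<open>Below the root the condition is inherited from the sections, so only the sign at the
  root has to be prescribed.\<close>

lemma parity_wreath:
  assumes "bij \<tau>" "\<And>x. f x \<in> parity_auts" "sign \<tau> = (\<Prod>x\<in>UNIV. root_sign (f x))"
  shows "wreath \<tau> f \<in> parity_auts"
proof (rule parity_coinduct)
  have t: "f x \<in> tree_aut" for x using assms(2) by (rule parity_tree_aut)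
  let ?X = "insert (wreath \<tau> f) parity_auts"
  show "wreath \<tau> f \<in> ?X" by simp
  show "?X \<subseteq> tree_aut" using assms(1) t by (auto simp: parity_tree_aut wreath_tree_aut)
  show "tree_section k [x] \<in> ?X" if "k \<in> ?X" for k x
    using that assms(2) t by (auto simp: section_wreath intro: parity_section)
  show "root_sign k = (\<Prod>x\<in>UNIV. root_sign (tree_section k [x]))" if "k \<in> ?X" for k
    using that assms(3) t by (auto simp: section_wreath intro: parity_root)
qed

text \<open>Indexing each generator by the letter it fixes makes the three wreath recursions uniform.\<close>

primrec gen :: "letter \<Rightarrow> vertex \<Rightarrow> vertex" where
  "gen L1 = hanoi_a"
| "gen L2 = hanoi_b"
| "gen L3 = hanoi_c"

declare gen.simps [simp del]

primrec flip :: "letter \<Rightarrow> letter \<Rightarrow> letter" where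
  "flip L1 = Transposition.transpose L2 L3"
| "flip L2 = Transposition.transpose L1 L3"
| "flip L3 = Transposition.transpose L1 L2"

lemma flip_simps:
  "flip x x = x" "x \<noteq> y \<Longrightarrow> x \<noteq> z \<Longrightarrow> y \<noteq> z \<Longrightarrow> flip x y = z"
  by (cases x; cases y; cases z; simp)+

lemma flip_eq_self_iff: "flip x y = x \<longleftrightarrow> y = x"
  by (cases x; cases y) simp_all

lemma flip_flip [simp]: "flip x (flip x y) = y"
  by (cases x) simp_all

lemma flip_cases:
  assumes "x \<noteq> y" "x \<noteq> z" "y \<noteq> z"
  shows "flip x y = z" "flip x z = y" "flip y x = z" "flip y z = x" "flip z x = y" "flip z y = x"
  using assms by (auto simp: flip_simps)

lemma gen_Nil [simp]: "gen x [] = []"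
  by (cases x) (simp_all add: gen.simps)

lemma gen_Cons: "gen x (y # w) = flip x y # (if y = x then gen x w else w)"
  by (cases x) (simp_all add: gen.simps)

lemma gen_wreath: "gen x = wreath (flip x) (\<lambda>y. if y = x then gen x else id)"
proof
  fix w show "gen x w = wreath (flip x) (\<lambda>y. if y = x then gen x else id) w"
    by (cases w) (simp_all add: gen_Cons)
qed

lemma gen_tree_aut: "gen x \<in> tree_aut"
  by (cases x) (simp_all add: gen.simps hanoi_tree_aut)

lemma sign_flip: "sign (flip x) = - 1"
  by (cases x) (simp_all add: sign_swap_id)

lemma root_sign_gen [simp]: "root_sign (gen x) = - 1"
  by (subst gen_wreath) (simp add: sign_flip)

lemma root_perm_gen [simp]: "root_perm (gen x) = flip x"
  by (subst gen_wreath) simp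

lemma gen_parity: "gen x \<in> parity_auts"
proof (rule parity_coinduct)
  let ?X = "{gen x, id}"
  have s: "tree_section (gen x) [y] = (if y = x then gen x else id)" for y
    by (subst gen_wreath, subst section_wreath) (auto simp: gen_tree_aut id_tree_aut)
  show "gen x \<in> ?X" by simp
  show "?X \<subseteq> tree_aut" by (auto simp: gen_tree_aut id_tree_aut)
  show "tree_section k [y] \<in> ?X" if "k \<in> ?X" for k y using that s by auto
  show "root_sign k = (\<Prod>y\<in>UNIV. root_sign (tree_section k [y]))" if "k \<in> ?X" for k
  proof -
    \<comment> \<open>The only non-trivial section is \<open>gen x\<close> itself, sitting at
      \<open>x\<close>, so the product of the signs is -1, the sign of
      \<open>flip x\<close>.\<close>
    have "(\<Prod>y\<in>UNIV. root_sign (tree_section (gen x) [y])) = (\<Prod>y\<in>UNIV. if y = x then - 1 else 1)"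
      unfolding s by (intro prod.cong) auto
    then show ?thesis using that by auto
  qed
qed

lemma gen_gen [simp]: "gen x (gen x w) = w"
  by (induction w) (auto simp: gen_Cons flip_eq_self_iff)

lemma gen_o_gen [simp]: "gen x \<circ> gen x = id" "gen x \<circ> (gen x \<circ> f) = f"
  by (auto simp: fun_eq_iff)

section \<open>Words in the generators\<close>

definition word :: "letter list \<Rightarrow> vertex \<Rightarrow> vertex" where
  "word w = foldr (\<lambda>x g. gen x \<circ> g) w id"

lemma word_simps [simp]: "word [] = id" "word (x # w) = gen x \<circ> word w"
  by (simp_all add: word_def)

lemma word_append: "word (u @ v) = word u \<circ> word v"
  by (induction u) (auto simp: comp_assoc)

lemma word_tree_aut: "word w \<in> tree_aut"
  by (induction w) (simp_all only: word_simps id_tree_aut gen_tree_aut tree_aut_comp)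

lemma word_parity: "word w \<in> parity_auts"
  by (induction w) (simp_all only: word_simps parity_id gen_parity parity_comp)

lemma word_rev: "word (rev w) \<circ> word w = id"
proof (induction w)
  case (Cons x w)
  then show ?case by (simp add: word_append comp_assoc)
qed simp

text \<open>The generators are involutions, so products of generators without formal inverses
  exhaust the group.\<close>

lemma hanoi_group_word: "hanoi_group = range word"
proof (rule subset_antisym)
  interpret group AutT by (rule group_AutT)
  show "hanoi_group \<subseteq> range word"
  proof
    fix g assume "g \<in> hanoi_group"
    then show "g \<in> range word"
      unfolding hanoi_group_def
    proof (induction g rule: generate.induct)
      case one
      show ?case unfolding AutT_simps word_simps(1)[symmetric] by (rule rangeI)
    next
      case (incl h)
      then obtain x where "h = gen x" by (metis empty_iff insert_iff gen.simps)
      then show ?case by (auto intro: range_eqI[of _ _ "[x]"])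
    next
      case (inv h)
      then obtain x where h: "h = gen x" by (metis empty_iff insert_iff gen.simps)
      have "inv\<^bsub>AutT\<^esub> (gen x) = gen x"
        by (rule inv_equality) (auto simp: gen_tree_aut)
      then show ?case unfolding h by (auto intro: range_eqI[of _ _ "[x]"])
    next
      case (eng h1 h2)
      then obtain u v where "h1 = word u" "h2 = word v" by blast
      then have "h1 \<otimes>\<^bsub>AutT\<^esub> h2 = word (u @ v)" unfolding AutT_simps by (simp only: word_append)
      then show ?case by blast
    qed
  qed
  show "range word \<subseteq> hanoi_group"
  proof
    fix g assume "g \<in> range word"
    then obtain w where "g = word w" by blast
    moreover have "word w \<in> hanoi_group"
    proof (induction w)
      case Nil
      show ?case using generate.one[of AutT]
        unfolding hanoi_group_def word_simps AutT_simps by blast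
    next
      case (Cons x w)
      have "gen x \<in> hanoi_group"
        unfolding hanoi_group_def by (rule generate.incl) (cases x; simp add: gen.simps)
      then show ?case
        using Cons generate.eng[of "gen x" AutT _ "word w"]
        unfolding hanoi_group_def word_simps AutT_simps by blast
    qed
    ultimately show "g \<in> hanoi_group" by simp
  qed
qed

section \<open>Sets of automorphisms containing all even words\<close>

text \<open>Named after the fact that such a set contains every word in which each generator occurs an even
  number of times.\<close>

definition even_closed :: "(vertex \<Rightarrow> vertex) set \<Rightarrow> bool" where
  "even_closed Q \<longleftrightarrow> id \<in> Q \<and> (\<forall>g\<in>Q. \<forall>h\<in>Q. g \<circ> h \<in> Q) \<and>
     (\<forall>x. \<forall>g\<in>Q. gen x \<circ> g \<circ> gen x \<in> Q) \<and>
     (\<forall>x y. gen x \<circ> gen y \<circ> gen x \<circ> gen y \<in> Q)"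

lemma even_closedD:
  assumes "even_closed Q"
  shows "id \<in> Q" "g \<in> Q \<Longrightarrow> h \<in> Q \<Longrightarrow> g \<circ> h \<in> Q" "g \<in> Q \<Longrightarrow> gen x \<circ> g \<circ> gen x \<in> Q"
    "gen x \<circ> gen y \<circ> gen x \<circ> gen y \<in> Q"
  using assms by (auto simp: even_closed_def)

lemma even_closed_word_conj:
  assumes "even_closed Q" "g \<in> Q"
  shows "word w \<circ> g \<circ> word (rev w) \<in> Q"
proof (induction w)
  case (Cons x w)
  show ?case using even_closedD(3)[OF assms(1) Cons, of x]
    by (simp only: rev.simps word_append word_simps comp_id comp_assoc)
qed (simp add: assms)

text \<open>Since \<open>word (rev u)\<close> inverts \<open>word u\<close>, this is the commutator
  [x, u]. The induction step is the identity [x, y u] = [x, y] y [x, u] y, in which the last y is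
  also the inverse of y.\<close>

lemma even_closed_commutator_gen:
  assumes "even_closed Q"
  shows "gen x \<circ> word u \<circ> gen x \<circ> word (rev u) \<in> Q"
proof (induction u)
  case Nil
  show ?case using even_closedD(1)[OF assms] by (simp only: rev.simps word_simps comp_id gen_o_gen)
next
  case (Cons y u)
  have "(gen x \<circ> gen y \<circ> gen x \<circ> gen y) \<circ> (gen y \<circ> (gen x \<circ> word u \<circ> gen x \<circ> word (rev u)) \<circ> gen y) \<in> Q"
    using Cons by (rule even_closedD(2)[OF assms even_closedD(4)[OF assms] even_closedD(3)[OF assms]])
  then show ?case by (simp only: rev.simps word_append word_simps comp_id comp_assoc gen_o_gen)
qed

text \<open>The first letter x occurs again, so the word reads x u x v. It equals [x, u] (u v), and
  u v is a shorter word whose letter counts are still even.\<close>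

lemma even_closed_word:
  assumes "even_closed Q" "\<And>x. even (count_list w x)"
  shows "word w \<in> Q"
  using assms(2)
proof (induction w rule: length_induct)
  case (1 w)
  show ?case
  proof (cases w)
    case Nil
    show ?thesis unfolding Nil word_simps by (rule even_closedD(1)[OF assms(1)])
  next
    case (Cons x w')
    have "odd (count_list w' x)" using "1.prems"[of x] Cons by simp
    then have "x \<in> set w'" by (metis count_list_0_iff even_zero)
    then obtain u v where w': "w' = u @ x # v" by (metis split_list)
    have "even (count_list (u @ v) y)" for y
      using "1.prems"[of y] by (auto simp: Cons w' split: if_splits)
    then have "word (u @ v) \<in> Q" using "1.IH" by (simp add: Cons w')
    then have "(gen x \<circ> word u \<circ> gen x \<circ> word (rev u)) \<circ> word (u @ v) \<in> Q"
      using assms(1) by (intro even_closedD even_closed_commutator_gen)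
    moreover have "(gen x \<circ> word u \<circ> gen x \<circ> word (rev u)) \<circ> word (u @ v) 
        = gen x \<circ> word u \<circ> gen x \<circ> (word (rev u) \<circ> word u) \<circ> word v"
      by (simp add: word_append comp_assoc)
    moreover have "gen x \<circ> word u \<circ> gen x \<circ> word v = word w"
      unfolding Cons w' word_append word_simps by (simp only: comp_assoc)
    ultimately show ?thesis by (simp only: word_rev comp_id)
  qed
qed

section \<open>Automorphisms supported below one vertex\<close>

text \<open>\<open>graft v k\<close> acts as \<open>k\<close> on the subtree at \<open>v\<close> and trivially elsewhere.\<close>

definition graft :: "vertex \<Rightarrow> (vertex \<Rightarrow> vertex) \<Rightarrow> vertex \<Rightarrow> vertex" where
  "graft v k = foldr (\<lambda>x g. wreath id (\<lambda>y. if y = x then g else id)) v k"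

lemma graft_simps [simp]:
  "graft [] k = k" "graft (x # v) k = wreath id (\<lambda>y. if y = x then graft v k else id)"
  by (simp_all only: graft_def foldr.simps id_apply comp_apply)

lemma graft_comp: "graft v (k \<circ> l) = graft v k \<circ> graft v l"
proof (induction v)
  case (Cons x v)
  show ?case unfolding graft_simps wreath_comp Cons by (rule wreath_cong) simp_all
qed simp

lemma graft_id [simp]: "graft v id = id"
  by (induction v) (simp_all only: graft_simps if_cancel wreath_id)

lemma graft_append: "graft (u @ v) k = graft u (graft v k)"
  by (simp add: graft_def)

text \<open>A strict ancestor of \<open>v\<close> acts trivially on its children and has at most one
  non-trivial section, so that section must have sign 1. This is why the sign is carried through the
  induction.\<close>

lemma graft_parity:
  assumes "k \<in> parity_auts" "root_sign k = 1"
  shows "graft v k \<in> parity_auts \<and> root_sign (graft v k) = 1"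
  by (induction v) (auto simp: assms parity_id intro!: parity_wreath prod.neutral[symmetric] prod.neutral)

text \<open>On the first level \<open>flip z\<close> conjugates \<open>flip y\<close> into
  \<open>flip x\<close>, so the four letters cancel there. Away from \<open>x\<close> the sections
  are the involution \<open>gen z\<close>: squaring such a word leaves only the section at
  \<open>x\<close>, and conjugating by it conjugates by \<open>gen z\<close> below the other two
  letters.\<close>

lemma word_conj_wreath:
  assumes "x \<noteq> y" "x \<noteq> z" "y \<noteq> z"
  shows "word [x, z, y, z] = wreath id (\<lambda>w. if w = x then gen x \<circ> gen y else gen z)"
    "word [z, y, z, x] = wreath id (\<lambda>w. if w = x then gen y \<circ> gen x else gen z)"
proof -
  have "word [x, z, y, z] u = wreath id (\<lambda>w. if w = x then gen x \<circ> gen y else gen z) u \<and>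
    word [z, y, z, x] u = wreath id (\<lambda>w. if w = x then gen y \<circ> gen x else gen z) u" for u
  proof (cases u)
    case (Cons a v)
    have "a = x \<or> a = y \<or> a = z"
      using distinct_letters_UNIV[OF assms] by blast
    then show ?thesis
      by (elim disjE)
        (simp_all add: Cons gen_Cons flip_simps(1) flip_cases[OF assms] assms assms[symmetric])
  qed simp
  then show "word [x, z, y, z] = wreath id (\<lambda>w. if w = x then gen x \<circ> gen y else gen z)"
    "word [z, y, z, x] = wreath id (\<lambda>w. if w = x then gen y \<circ> gen x else gen z)"
    by blast+
qed

text \<open>The generator \<open>gen y\<close> swaps \<open>x\<close> and \<open>z\<close> and has
  trivial sections at both, so \<open>k\<close> is transported unchanged.\<close>

lemma gen_conj_graft:
  assumes "x \<noteq> y" "x \<noteq> z" "y \<noteq> z"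
  shows "gen y \<circ> graft [x] k \<circ> gen y = graft [z] k"
proof
  fix u
  show "(gen y \<circ> graft [x] k \<circ> gen y) u = graft [z] k u"
  proof (cases u)
    case (Cons a v)
    have "a = x \<or> a = y \<or> a = z"
      using distinct_letters_UNIV[OF assms] by blast
    then show ?thesis
      by (elim disjE)
        (simp_all add: Cons gen_Cons flip_simps(1) flip_cases[OF assms] assms assms[symmetric])
  qed simp
qed

text \<open>This is the self-similarity behind the density argument: each closure property of
  \<open>Q\<close> is pulled back through words whose first-level action is trivial.\<close>

lemma even_closed_graft:
  assumes "even_closed Q"
  shows "even_closed {k. graft [i] k \<in> Q}"
  unfolding even_closed_def mem_Collect_eq
proof (intro conjI allI ballI)
  show "graft [i] id \<in> Q" using even_closedD(1)[OF assms] by (simp add: wreath_id)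
  show "graft [i] (g \<circ> h) \<in> Q" if "g \<in> {k. graft [i] k \<in> Q}" "h \<in> {k. graft [i] k \<in> Q}" for g h
    using that assms unfolding graft_comp mem_Collect_eq by (intro even_closedD)
  show "graft [i] (gen s \<circ> k \<circ> gen s) \<in> Q" if k: "k \<in> {k. graft [i] k \<in> Q}" for s k
  proof -
    \<comment> \<open>With \<open>x\<close> different from \<open>i\<close>, the word
      \<open>[x, s, y, s]\<close> fixes the first level and has section \<open>gen s\<close> at
      \<open>i\<close>, so it realizes the conjugation below \<open>i\<close>.\<close>
    obtain x y where d: "x \<noteq> y" "x \<noteq> s" "y \<noteq> s" "x \<noteq> i"
      by (cases i; cases s; metis letter.distinct)
    have "word [x, s, y, s] \<circ> graft [i] k \<circ> word (rev [x, s, y, s]) \<in> Q"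
      using k by (intro even_closed_word_conj assms) simp
    moreover have "word [x, s, y, s] \<circ> graft [i] k \<circ> word (rev [x, s, y, s])
       = graft [i] (gen s \<circ> k \<circ> gen s)"
      using d unfolding rev.simps append.simps word_conj_wreath[OF d(1-3)] graft_simps wreath_comp
      by (intro wreath_cong) (auto simp: fun_eq_iff)
    ultimately show ?thesis by simp
  qed
  show "graft [i] (gen s \<circ> gen t \<circ> gen s \<circ> gen t) \<in> Q" for s t
  proof (cases "s = t")
    case True
    then show ?thesis using even_closedD(1)[OF assms] by (simp add: wreath_id comp_assoc)
  next
    case False
    obtain z where z: "s \<noteq> z" "t \<noteq> z" by (cases s; cases t; metis letter.distinct)
    \<comment> \<open>Each generator occurs an even number of times in both squares. The reversed
      pattern in the second one produces the same element (st)(st) at \<open>t\<close>, rather than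
      (ts)(ts).\<close>
    have "word ([s, z, t, z] @ [s, z, t, z]) \<in> Q" "word ([z, s, z, t] @ [z, s, z, t]) \<in> Q"
      by (rule even_closed_word[OF assms]; auto)+
    moreover have "word ([s, z, t, z] @ [s, z, t, z]) = graft [s] (gen s \<circ> gen t \<circ> gen s \<circ> gen t)"
      unfolding word_append word_conj_wreath(1)[OF False z] graft_simps wreath_comp
      by (intro wreath_cong) (simp_all add: comp_assoc)
    moreover have "word ([z, s, z, t] @ [z, s, z, t]) = graft [t] (gen s \<circ> gen t \<circ> gen s \<circ> gen t)"
      unfolding word_append word_conj_wreath(2)[OF False[symmetric] z(2,1)] graft_simps wreath_comp
      by (intro wreath_cong) (simp_all add: comp_assoc)
    ultimately have s: "graft [s] (gen s \<circ> gen t \<circ> gen s \<circ> gen t) \<in> Q"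
      and t: "graft [t] (gen s \<circ> gen t \<circ> gen s \<circ> gen t) \<in> Q" by simp_all
    have "i = s \<or> i = t \<or> i = z"
      using distinct_letters_UNIV[of s t z] False z by blast
    \<comment> \<open>The third letter is reached from \<open>s\<close> by conjugation with
      \<open>gen t\<close>.\<close>
    moreover have "graft [z] (gen s \<circ> gen t \<circ> gen s \<circ> gen t) \<in> Q"
      using even_closedD(3)[OF assms s, of t] gen_conj_graft[of s t z] False z by simp
    ultimately show ?thesis using s t by blast
  qed
qed

text \<open>All levels up to \<open>n\<close> are compared, so that agreement passes to smaller
  levels for arbitrary functions. For tree automorphisms it amounts to agreement on level
  \<open>n\<close> alone.\<close>

definition agree :: "nat \<Rightarrow> (vertex \<Rightarrow> vertex) \<Rightarrow> (vertex \<Rightarrow> vertex) \<Rightarrow> bool" where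
  "agree n g h \<longleftrightarrow> (\<forall>w. length w \<le> n \<longrightarrow> g w = h w)"

lemma agree_comp_left: "agree n g h \<Longrightarrow> agree n (p \<circ> g) (p \<circ> h)"
  by (simp add: agree_def)

lemma agree_wreath: "(\<And>x. agree n (f x) (h x)) \<Longrightarrow> agree (Suc n) (wreath \<tau> f) (wreath \<tau> h)"
  unfolding agree_def
proof (intro allI impI)
  fix w :: vertex
  assume "\<And>x. \<forall>w. length w \<le> n \<longrightarrow> f x w = h x w" "length w \<le> Suc n"
  then show "wreath \<tau> f w = wreath \<tau> h w" by (cases w) auto
qed

lemma agree_graft: "agree n k l \<Longrightarrow> agree n (graft v k) (graft v l)"
proof (induction v)
  case (Cons x v)
  then have "agree n (graft v k) (graft v l)" by simp
  then have "agree (Suc n) (graft (x # v) k) (graft (x # v) l)"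
    unfolding graft_simps by (intro agree_wreath) (simp add: agree_def)
  then show ?case by (simp add: agree_def)
qed simp

lemma wreath_id_graft:
  "wreath id f = graft [L1] (f L1) \<circ> graft [L2] (f L2) \<circ> graft [L3] (f L3)"
  unfolding graft_simps wreath_comp
  by (intro wreath_cong) (simp_all, metis comp_id id_comp letter.exhaust)


section \<open>Density and the closure of the Hanoi group\<close>

text \<open>A non-trivial even permutation of three letters has no fixed point and is one of two
  3-cycles. Each is undone by the first-level action of the square of \<open>gen L1\<close> and
  \<open>gen L2\<close> multiplied in one of the two orders.\<close>

lemma even_word_rotation:
  fixes \<tau> :: "letter \<Rightarrow> letter"
  assumes "bij \<tau>" "sign \<tau> = 1"
  shows "\<exists>e. (\<forall>x. even (count_list e x)) \<and> root_perm (word e) \<circ> \<tau> = id"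
proof (cases "\<tau> = id")
  case True
  then show ?thesis by (intro exI[of _ "[]"]) (simp only: word_simps root_perm_id, simp)
next
  case False
  have act4: "root_perm (word [x, y, x, y]) = flip x \<circ> flip y \<circ> flip x \<circ> flip y" for x y
    using word_tree_aut by (simp only: word_simps comp_id root_perm_comp root_perm_gen gen_tree_aut tree_aut_comp comp_assoc)
  have nofix: "\<tau> x \<noteq> x" for x
    using sign_letter_fixed_point[OF assms, of x] False by blast
  have inj: "\<tau> x = \<tau> y \<longleftrightarrow> x = y" for x y
    using assms(1) by (meson bij_is_inj injD)
  have "\<tau> L1 = L2 \<and> \<tau> L2 = L3 \<and> \<tau> L3 = L1 \<or> \<tau> L1 = L3 \<and> \<tau> L2 = L1 \<and> \<tau> L3 = L2"
    using nofix[of L1] nofix[of L2] nofix[of L3] inj[of L1 L2] inj[of L1 L3] inj[of L2 L3]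
    by (cases "\<tau> L1"; cases "\<tau> L2"; cases "\<tau> L3"; simp)
  then show ?thesis
  proof
    assume *: "\<tau> L1 = L2 \<and> \<tau> L2 = L3 \<and> \<tau> L3 = L1"
    have "(flip L1 \<circ> flip L2 \<circ> flip L1 \<circ> flip L2 \<circ> \<tau>) x = id x" for x
      using * by (cases x) simp_all
    then show ?thesis
      by (intro exI[of _ "[L1, L2, L1, L2]"]) (auto simp only: act4, auto)
  next
    assume *: "\<tau> L1 = L3 \<and> \<tau> L2 = L1 \<and> \<tau> L3 = L2"
    have "(flip L2 \<circ> flip L1 \<circ> flip L2 \<circ> flip L1 \<circ> \<tau>) x = id x" for x
      using * by (cases x) simp_all
    then show ?thesis
      by (intro exI[of _ "[L2, L1, L2, L1]"]) (auto simp only: act4, auto)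
  qed
qed

text \<open>An even word and its inverse lie in every \<open>even_closed\<close> set. Hence
  approximating \<open>k\<close> is reduced to approximating three sections that again satisfy the
  hypotheses on \<open>k\<close>.\<close>

lemma even_word_normalize:
  assumes "k \<in> parity_auts" "root_sign k = 1"
  obtains e f where "\<And>x. even (count_list e x)" "word e \<circ> k = wreath id f"
    "\<And>x. f x \<in> parity_auts" "\<And>x. root_sign (f x) = 1"
proof -
  have k: "k \<in> tree_aut" using assms(1) by (rule parity_tree_aut)
  obtain e where e: "\<forall>x. even (count_list e x)" "root_perm (word e) \<circ> root_perm k = id"
    using even_word_rotation[OF root_perm_bij[OF k]] assms(2) by (auto simp: root_sign_def)
  define k' where "k' = word e \<circ> k"
  define f where "f = (\<lambda>x. tree_section k' [x])"
  have k': "k' \<in> parity_auts" unfolding k'_def by (intro parity_comp word_parity assms)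
  have root_perm: "root_perm k' = id" unfolding k'_def root_perm_comp[OF word_tree_aut k] by (rule e)
  have wreath: "k' = wreath id f"
    using wreath_decomp[OF parity_tree_aut[OF k']] unfolding root_perm f_def .
  have f: "f x \<in> parity_auts" for x unfolding f_def by (rule parity_section[OF k'])
  have "root_sign k' = 1" unfolding root_sign_def root_perm by simp
  then have prod: "root_sign (f L1) * (root_sign (f L2) * root_sign (f L3)) = 1"
    using parity_root[OF k'] unfolding f_def by (simp add: UNIV_letter)
  \<comment> \<open>The product of the three signs is 1, so either none or exactly two of them are
    -1.\<close>
  consider "\<forall>x. root_sign (f x) = 1" |
    x y z where "x \<noteq> y" "x \<noteq> z" "y \<noteq> z" "root_sign (f x) = - 1" "root_sign (f y) = - 1" "root_sign (f z) = 1"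
  proof -
    have "root_sign (f L1) = 1 \<and> root_sign (f L2) = 1 \<and> root_sign (f L3) = 1 \<or>
      root_sign (f L1) = - 1 \<and> root_sign (f L2) = - 1 \<and> root_sign (f L3) = 1 \<or>
      root_sign (f L1) = - 1 \<and> root_sign (f L3) = - 1 \<and> root_sign (f L2) = 1 \<or>
      root_sign (f L2) = - 1 \<and> root_sign (f L3) = - 1 \<and> root_sign (f L1) = 1"
      using prod root_sign_cases[of "f L1"] root_sign_cases[of "f L2"] root_sign_cases[of "f L3"]
      by auto
    moreover have "(\<forall>x. root_sign (f x) = 1) \<longleftrightarrow> 
      root_sign (f L1) = 1 \<and> root_sign (f L2) = 1 \<and> root_sign (f L3) = 1"
      by (metis letter.exhaust)
    ultimately show ?thesis
      using that(1) that(2)[of L1 L2 L3] that(2)[of L1 L3 L2] that(2)[of L2 L3 L1] by auto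
  qed
  then show ?thesis
  proof cases
    case 1
    then show ?thesis using that[of e f] e(1) wreath f unfolding k'_def by blast
  next
    case (2 x y z)
    \<comment> \<open>The correcting word acts trivially on the first level, and its sections are
      odd at \<open>x\<close> and \<open>y\<close> and even at \<open>z\<close>, which repairs
      exactly the two wrong signs.\<close>
    define E where "E = [x, z, y, z] @ [y, z, x, z]"
    define g where "g = (\<lambda>w. (if w = x then gen x \<circ> gen y else gen z) \<circ> (if w = y then gen y \<circ> gen x else gen z))"
    have E: "word E = wreath id g"
      unfolding E_def g_def word_append word_conj_wreath(1)[OF 2(1,2,3)]
        word_conj_wreath(1)[OF 2(1)[symmetric] 2(3,2)] wreath_comp by (intro wreath_cong) simp_all
    have g: "g w \<in> parity_auts" for w
      unfolding g_def by (auto intro!: parity_comp gen_parity parity_id)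
    have g_sign: "root_sign (g w) = (if w = z then 1 else - 1)" for w
      unfolding g_def using distinct_letters_UNIV[OF 2(1,2,3)] 2(1,2,3)
      by (auto simp: root_sign_comp gen_tree_aut tree_aut_comp)
    show ?thesis
    proof (rule that[of "E @ e" "\<lambda>w. g w \<circ> f w"])
      show "even (count_list (E @ e) w)" for w using e(1) by (auto simp: E_def)
      show "word (E @ e) \<circ> k = wreath id (\<lambda>w. g w \<circ> f w)"
        unfolding word_append comp_assoc k'_def[symmetric] E wreath wreath_comp by (rule wreath_cong) simp_all
      show "g w \<circ> f w \<in> parity_auts" for w by (intro parity_comp g f)
      show "root_sign (g w \<circ> f w) = 1" for w
      proof -
        have "w = x \<or> w = y \<or> w = z" using distinct_letters_UNIV[OF 2(1,2,3)] by blast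
        then have "root_sign (g w) * root_sign (f w) = 1"
          using 2 by (elim disjE) (simp_all add: g_sign)
        then show ?thesis
          unfolding root_sign_comp[OF parity_tree_aut[OF g] parity_tree_aut[OF f]] .
      qed
    qed
  qed
qed

text \<open>The induction varies \<open>Q\<close>: the section at \<open>x\<close> is approximated
  inside the set of all \<open>d\<close> with \<open>graft [x] d \<in> Q\<close>, and the product of
  the three grafts lies in \<open>Q\<close> again. One level of accuracy is gained in each
  step.\<close>

lemma even_closed_dense:
  assumes "even_closed Q" "k \<in> parity_auts" "root_sign k = 1"
  shows "\<exists>d\<in>Q. agree n k d"
  using assms
proof (induction n arbitrary: Q k)
  case 0
  then have "agree 0 k id"
    by (simp add: agree_def tree_aut_Nil parity_tree_aut)
  then show ?case using even_closedD(1)[OF 0(1)] by blast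
next
  case (Suc n)
  obtain e f where e: "\<And>x. even (count_list e x)" and ef: "word e \<circ> k = wreath id f"
    and f: "\<And>x. f x \<in> parity_auts" "\<And>x. root_sign (f x) = 1"
    using even_word_normalize[OF Suc.prems(2,3)] by blast
  have "\<exists>d. graft [x] d \<in> Q \<and> agree n (f x) d" for x
    using Suc.IH[OF even_closed_graft[OF Suc.prems(1)] f, of x] by blast
  then obtain d where d: "\<And>x. graft [x] (d x) \<in> Q" "\<And>x. agree n (f x) (d x)" by metis
  have "wreath id d \<in> Q"
    unfolding wreath_id_graft by (intro even_closedD(2)[OF Suc.prems(1)] d)
  moreover have "word (rev e) \<in> Q"
    by (rule even_closed_word[OF Suc.prems(1)]) (simp add: e)
  ultimately have "word (rev e) \<circ> wreath id d \<in> Q" by (rule even_closedD(2)[OF Suc.prems(1), rotated])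
  moreover have "k = word (rev e) \<circ> wreath id f"
    unfolding ef[symmetric] comp_assoc[symmetric] word_rev by simp
  moreover have "agree (Suc n) (word (rev e) \<circ> wreath id f) (word (rev e) \<circ> wreath id d)"
    by (intro agree_comp_left agree_wreath d)
  ultimately show ?case by blast
qed

section \<open>The topology expressed by agreement up to a level\<close>

lemma agree_trans: "agree n g h \<Longrightarrow> agree n h k \<Longrightarrow> agree n g k"
  by (simp add: agree_def)

lemma agree_refl: "agree n g g"
  by (simp add: agree_def)

lemma agree_comp:
  assumes "h' \<in> tree_aut" "agree n g g'" "agree n h h'"
  shows "agree n (g \<circ> h) (g' \<circ> h')"
  using assms by (auto simp: agree_def tree_aut_length)

lemma agree_ginv:
  assumes "g \<in> tree_aut" "h \<in> tree_aut" "agree n g h"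
  shows "agree n (ginv g) (ginv h)"
  unfolding agree_def
proof (intro allI impI)
  fix w :: vertex assume "length w \<le> n"
  then have "length (ginv h w) \<le> n"
    using tree_aut_length[OF tree_aut_inv[OF assms(2)]] by simp
  then have "g (ginv h w) = w"
    using assms(2,3) by (simp add: agree_def tree_aut_ginv_apply)
  then show "ginv g w = ginv h w"
    using assms(1) by (metis tree_aut_ginv_apply(2))
qed

lemma agree_iff_level:
  assumes "g \<in> tree_aut" "h \<in> tree_aut"
  shows "agree n g h \<longleftrightarrow> (\<forall>v. length v = n \<longrightarrow> g v = h v)"
proof
  assume *: "\<forall>v. length v = n \<longrightarrow> g v = h v"
  show "agree n g h"
    unfolding agree_def
  proof (intro allI impI)
    fix w :: vertex assume w: "length w \<le> n"
    define u where "u = replicate (n - length w) L1"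
    have "g (w @ u) = h (w @ u)" using * w by (simp add: u_def)
    then have "g w @ tree_section g w u = h w @ tree_section h w u"
      using tree_section_eq[OF assms(1)] tree_section_eq[OF assms(2)] by simp
    then show "g w = h w"
      using tree_aut_length[OF assms(1)] tree_aut_length[OF assms(2)]
      by (simp add: append_eq_append_conv)
  qed
qed (simp add: agree_def)

text \<open>Cosets of level stabilizers are balls for \<open>agree\<close>, which turns every
  topological question below into one about finite levels.\<close>

lemma coset_level_stab_iff:
  assumes "g \<in> tree_aut"
  shows "h \<in> g <#\<^bsub>AutT\<^esub> level_stab n \<longleftrightarrow> h \<in> tree_aut \<and> agree n g h"
proof
  assume "h \<in> g <#\<^bsub>AutT\<^esub> level_stab n"
  then obtain s where s: "s \<in> tree_aut" "\<forall>v. length v = n \<longrightarrow> s v = v" and h: "h = g \<circ> s"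
    by (auto simp: l_coset_def level_stab_def)
  then show "h \<in> tree_aut \<and> agree n g h"
    using assms tree_aut_comp agree_iff_level by (metis comp_apply)
next
  assume h: "h \<in> tree_aut \<and> agree n g h"
  have "ginv g \<circ> h \<in> level_stab n"
    using h assms tree_aut_comp[OF tree_aut_inv[OF assms], of h]
    by (auto simp: level_stab_def agree_iff_level) (metis tree_aut_ginv_apply(2))
  moreover have "h = g \<circ> (ginv g \<circ> h)"
    using assms by (simp only: comp_assoc[symmetric] tree_aut_ginv id_comp)
  ultimately show "h \<in> g <#\<^bsub>AutT\<^esub> level_stab n"
    unfolding l_coset_def AutT_simps by blast
qed

lemma openin_AutT_iff:
  "openin AutT_topology U \<longleftrightarrow>
     U \<subseteq> tree_aut \<and> (\<forall>g\<in>U. \<exists>n. \<forall>h\<in>tree_aut. agree n g h \<longrightarrow> h \<in> U)"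
proof (cases "U \<subseteq> tree_aut")
  case True
  then have "g <#\<^bsub>AutT\<^esub> level_stab n \<subseteq> U \<longleftrightarrow> (\<forall>h\<in>tree_aut. agree n g h \<longrightarrow> h \<in> U)"
    if "g \<in> U" for g n
    using coset_level_stab_iff[of g] that by blast
  with True show ?thesis unfolding openin_AutT_topology by blast
qed (simp add: openin_AutT_topology)

lemma openin_agree_ball:
  assumes "g \<in> tree_aut"
  shows "openin AutT_topology {h \<in> tree_aut. agree n g h}"
  unfolding openin_AutT_iff by (auto intro: agree_trans)

lemma openin_subtopology_AutT_iff:
  assumes "S \<subseteq> tree_aut"
  shows "openin (subtopology AutT_topology S) U \<longleftrightarrow>
     U \<subseteq> S \<and> (\<forall>g\<in>U. \<exists>n. \<forall>h\<in>S. agree n g h \<longrightarrow> h \<in> U)"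
proof
  assume "openin (subtopology AutT_topology S) U"
  then obtain V where V: "openin AutT_topology V" "U = V \<inter> S"
    by (auto simp: openin_subtopology)
  then show "U \<subseteq> S \<and> (\<forall>g\<in>U. \<exists>n. \<forall>h\<in>S. agree n g h \<longrightarrow> h \<in> U)"
  proof (intro conjI ballI)
    fix g assume "g \<in> U"
    then obtain n where "\<forall>h\<in>tree_aut. agree n g h \<longrightarrow> h \<in> V"
      using V unfolding openin_AutT_iff by blast
    then show "\<exists>n. \<forall>h\<in>S. agree n g h \<longrightarrow> h \<in> U"
      using assms V(2) by (intro exI[of _ n]) blast
  qed (use V(2) in blast)
next
  assume U: "U \<subseteq> S \<and> (\<forall>g\<in>U. \<exists>n. \<forall>h\<in>S. agree n g h \<longrightarrow> h \<in> U)"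
  then obtain n where n: "\<And>g h. g \<in> U \<Longrightarrow> h \<in> S \<Longrightarrow> agree (n g) g h \<Longrightarrow> h \<in> U"
    by metis
  \<comment> \<open>An open subset of the whole group that cuts out \<open>U\<close> is the union of
    the witnessing balls, now taken in \<open>tree_aut\<close>.\<close>
  define V where "V = (\<Union>g\<in>U. {h \<in> tree_aut. agree (n g) g h})"
  have "openin AutT_topology V"
    unfolding V_def using U assms by (intro openin_Union) (auto intro: openin_agree_ball)
  moreover have "U = V \<inter> S"
  proof (rule subset_antisym)
    show "V \<inter> S \<subseteq> U" unfolding V_def using n by blast
    show "U \<subseteq> V \<inter> S"
    proof
      fix g assume "g \<in> U"
      moreover from this U assms have "g \<in> S" "g \<in> tree_aut" by blast+
      ultimately show "g \<in> V \<inter> S" unfolding V_def using agree_refl by blast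
    qed
  qed
  ultimately show "openin (subtopology AutT_topology S) U"
    by (auto simp: openin_subtopology)
qed

lemma closure_AutT_iff:
  "g \<in> AutT_topology closure_of S \<longleftrightarrow> g \<in> tree_aut \<and> (\<forall>n. \<exists>h\<in>S \<inter> tree_aut. agree n g h)"
proof
  assume g: "g \<in> AutT_topology closure_of S"
  then have t: "g \<in> tree_aut" by (simp add: in_closure_of topspace_AutT_topology)
  have "\<exists>h\<in>S \<inter> tree_aut. agree n g h" for n
  proof -
    have "g \<in> {h \<in> tree_aut. agree n g h}" using t by (simp add: agree_refl)
    then have "\<exists>h. h \<in> S \<and> h \<in> {h \<in> tree_aut. agree n g h}"
      by (rule g[unfolded in_closure_of, THEN conjunct2, THEN spec, THEN mp, OF conjI[OF _ openin_agree_ball[OF t]]])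
    then show ?thesis by blast
  qed
  with t show "g \<in> tree_aut \<and> (\<forall>n. \<exists>h\<in>S \<inter> tree_aut. agree n g h)" by blast
next
  assume g: "g \<in> tree_aut \<and> (\<forall>n. \<exists>h\<in>S \<inter> tree_aut. agree n g h)"
  show "g \<in> AutT_topology closure_of S"
    unfolding in_closure_of topspace_AutT_topology openin_AutT_iff
  proof (intro conjI allI impI)
    fix T assume "g \<in> T \<and> T \<subseteq> tree_aut \<and> (\<forall>g\<in>T. \<exists>n. \<forall>h\<in>tree_aut. agree n g h \<longrightarrow> h \<in> T)"
    then obtain n where n: "\<forall>h\<in>tree_aut. agree n g h \<longrightarrow> h \<in> T" by blast
    from g obtain h where "h \<in> S \<inter> tree_aut" "agree n g h" by blast
    with n show "\<exists>y. y \<in> S \<and> y \<in> T" by blast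
  qed (use g in blast)
qed

lemma parity_subset: "parity_auts \<subseteq> tree_aut"
  by (auto simp: parity_tree_aut)

lemma section_agree:
  assumes "agree (length v + n) g h"
  shows "agree n (tree_section g v) (tree_section h v)"
  using assms by (auto simp: agree_def tree_section_def)

lemma root_sign_agree: "agree (Suc n) g h \<Longrightarrow> root_sign g = root_sign h"
proof -
  assume "agree (Suc n) g h"
  then have "root_perm g = root_perm h" by (auto simp: agree_def root_perm_def)
  then show ?thesis by (simp add: root_sign_def)
qed

lemma even_closed_range: "even_closed (range word)"
  unfolding even_closed_def
proof (intro conjI allI ballI)
  show "id \<in> range word" by (metis rangeI word_simps(1))
  show "g \<circ> h \<in> range word" if "g \<in> range word" "h \<in> range word" for g h
  proof -
    from that obtain u v where "g = word u" "h = word v" by blast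
    then have "g \<circ> h = word (u @ v)" by (simp only: word_append)
    then show ?thesis by blast
  qed
  show "gen x \<circ> g \<circ> gen x \<in> range word" if g: "g \<in> range word" for g x
  proof -
    obtain u where "g = word u" using g by blast
    then have "gen x \<circ> g \<circ> gen x = word (x # u @ [x])"
      by (simp only: word_append word_simps comp_id comp_assoc)
    then show ?thesis by blast
  qed
  show "gen x \<circ> gen y \<circ> gen x \<circ> gen y \<in> range word" for x y
  proof -
    have "gen x \<circ> gen y \<circ> gen x \<circ> gen y = word [x, y, x, y]"
      by (simp only: word_simps comp_id comp_assoc)
    then show ?thesis by blast
  qed
qed

lemma hanoi_closure_eq: "hanoi_closure = parity_auts"
proof (rule subset_antisym)
  show "hanoi_closure \<subseteq> parity_auts"
  proof
    fix g assume "g \<in> hanoi_closure"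
    then have g: "g \<in> tree_aut" and approx: "\<And>n. \<exists>w. agree n g (word w)"
      unfolding hanoi_closure_def closure_AutT_iff hanoi_group_word by blast+
    show "g \<in> parity_auts"
      unfolding parity_auts_def mem_Collect_eq
    proof (intro conjI allI g)
      fix v :: vertex
      \<comment> \<open>The condition at \<open>v\<close> involves the local permutations at
        \<open>v\<close> and at its children, hence the action up to level
        \<open>length v + 2\<close>.\<close>
      obtain w where w: "agree (length v + 2) g (word w)" using approx by blast
      have "root_sign (tree_section g v) = root_sign (tree_section (word w) v)"
        using section_agree[of v 2, OF w] root_sign_agree[of 1] by (simp add: numeral_2_eq_2)
      moreover have "root_sign (tree_section g (v @ [x])) = root_sign (tree_section (word w) (v @ [x]))" for x
        using section_agree[of "v @ [x]" 1 g] w root_sign_agree[of 0] by (simp add: numeral_2_eq_2)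
      moreover have "root_sign (tree_section (word w) v) = (\<Prod>x\<in>UNIV. root_sign (tree_section (word w) (v @ [x])))"
        using word_parity[of w] unfolding parity_auts_def by blast
      ultimately show "root_sign (tree_section g v) = (\<Prod>x\<in>UNIV. root_sign (tree_section g (v @ [x])))"
        by simp
    qed
  qed
  show "parity_auts \<subseteq> hanoi_closure"
  proof
    fix g assume g: "g \<in> parity_auts"
    have "\<exists>w. agree n g (word w)" for n
    proof (cases "root_sign g = 1")
      case True
      then show ?thesis using even_closed_dense[OF even_closed_range g] by blast
    next
      case False
      \<comment> \<open>Density covers sign 1 only; an odd element is made even by one generator,
        which is put back at the end.\<close>
      then have "root_sign (gen L1 \<circ> g) = 1"
        using root_sign_cases[of g] root_sign_comp[OF gen_tree_aut parity_tree_aut[OF g], of L1] by simp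
      then obtain w where "agree n (gen L1 \<circ> g) (word w)"
        using even_closed_dense[OF even_closed_range parity_comp[OF gen_parity g]] by blast
      then have "agree n (gen L1 \<circ> (gen L1 \<circ> g)) (gen L1 \<circ> word w)"
        by (rule agree_comp_left)
      then have "agree n g (word (L1 # w))"
        by (simp only: gen_o_gen word_simps)
      then show ?thesis by blast
    qed
    then show "g \<in> hanoi_closure"
      using g parity_tree_aut word_tree_aut
      unfolding hanoi_closure_def closure_AutT_iff hanoi_group_word by blast
  qed
qed

lemma parity_subgroup: "subgroup parity_auts AutT"
proof (unfold_locales)
  show "inv\<^bsub>AutT\<^esub> g \<in> parity_auts" if "g \<in> parity_auts" for g
  proof -
    have "inv\<^bsub>AutT\<^esub> g = ginv g"
      using that by (intro group.inv_equality[OF group_AutT]) (simp_all add: parity_tree_aut tree_aut_inv)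
    then show ?thesis using parity_ginv[OF that] by simp
  qed
  show "parity_auts \<subseteq> carrier AutT" using parity_subset by simp
qed (simp_all add: parity_id parity_comp del: id_apply)


section \<open>Closed normal subgroups\<close>

lemma ginv_wreath_id:
  assumes "\<And>x. f x \<in> tree_aut"
  shows "ginv (wreath id f) = wreath id (\<lambda>x. ginv (f x))"
proof (rule ginv_unique)
  show "wreath id f \<in> tree_aut" by (intro wreath_tree_aut assms bij_id)
  show "wreath id (\<lambda>x. ginv (f x)) \<circ> wreath id f = id"
    unfolding wreath_id_comp tree_aut_ginv(2)[OF assms] by (rule wreath_id)
qed

lemma ginv_gen: "ginv (gen x) = gen x"
  by (rule ginv_unique) (rule gen_tree_aut, rule gen_o_gen)

lemma graft_tree_aut: "k \<in> tree_aut \<Longrightarrow> graft v k \<in> tree_aut"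
proof (induction v)
  case (Cons x v)
  then show ?case unfolding graft_simps by (intro wreath_tree_aut bij_id) (simp add: id_tree_aut)
qed simp

lemma ginv_graft:
  assumes "k \<in> tree_aut" shows "ginv (graft v k) = graft v (ginv k)"
proof (rule ginv_unique)
  show "graft v k \<in> tree_aut" using assms by (rule graft_tree_aut)
  show "graft v (ginv k) \<circ> graft v k = id"
    unfolding graft_comp[symmetric] tree_aut_ginv(2)[OF assms] by (rule graft_id)
qed

text \<open>Distinct vertices on the same level have disjoint subtrees.\<close>

lemma graft_commute:
  assumes "length u = length v" "u \<noteq> v"
  shows "graft u k \<circ> graft v l = graft v l \<circ> graft u k"
  using assms
proof (induction u v rule: list_induct2)
  case (Cons x u y v)
  show ?case
  proof (cases "x = y")
    case True
    then have "u \<noteq> v" using Cons.prems by simp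
    then have eq: "graft u k \<circ> graft v l = graft v l \<circ> graft u k" by (rule Cons.IH)
    show ?thesis
      unfolding graft_simps wreath_id_comp True
    proof (rule wreath_cong)
      show "(if i = y then graft u k else id) \<circ> (if i = y then graft v l else id) =
        (if i = y then graft v l else id) \<circ> (if i = y then graft u k else id)" for i
        by (cases "i = y") (simp_all only: if_True if_False simp_thms eq)
    qed simp
  next
    case False
    then show ?thesis
      unfolding graft_simps wreath_id_comp by (intro wreath_cong) simp_all
  qed
qed simp

text \<open>Keeping \<open>g\<close> on the right instead of \<open>ginv g\<close> makes both sides
  wreath forms with the same root permutation, which can be compared letter by letter.\<close>

lemma graft_conj_aux:
  assumes "g \<in> tree_aut"
  shows "g \<circ> graft v k = graft (g v) (tree_section g v \<circ> k \<circ> ginv (tree_section g v)) \<circ> g"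
  using assms
proof (induction v arbitrary: g)
  case Nil
  show ?case
    unfolding tree_aut_Nil[OF Nil] section_Nil[OF Nil] graft_simps comp_assoc tree_aut_ginv[OF Nil] comp_id ..
next
  case (Cons x v)
  define f where "f = (\<lambda>x. tree_section g [x])"
  define s where "s = tree_section g (x # v)"
  have f: "f y \<in> tree_aut" for y unfolding f_def by (rule section_tree_aut[OF Cons.prems])
  have g: "g = wreath (root_perm g) f" unfolding f_def by (rule wreath_decomp[OF Cons.prems])
  have s: "tree_section (f x) v = s" unfolding f_def s_def by (simp add: section_append[OF Cons.prems])
  have gv: "g (x # v) = root_perm g x # f x v" by (subst g) simp
  have inj: "root_perm g y = root_perm g x \<longleftrightarrow> y = x" for y
    using root_perm_bij[OF Cons.prems] by (meson bij_is_inj injD)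
  have IH: "f x \<circ> graft v k = graft (f x v) (s \<circ> k \<circ> ginv s) \<circ> f x"
    using Cons.IH[OF f[of x]] unfolding s .
  have "wreath (root_perm g) f \<circ> graft (x # v) k = graft (root_perm g x # f x v) (s \<circ> k \<circ> ginv s) \<circ> wreath (root_perm g) f"
    unfolding graft_simps wreath_comp by (rule wreath_cong) (simp_all add: inj IH)
  then show ?case
    unfolding gv s_def[symmetric] g[symmetric] .
qed

lemma graft_conj:
  assumes "g \<in> tree_aut"
  shows "g \<circ> graft v k \<circ> ginv g = graft (g v) (tree_section g v \<circ> k \<circ> ginv (tree_section g v))"
  unfolding graft_conj_aux[OF assms] comp_assoc tree_aut_ginv[OF assms] comp_id ..

text \<open>At each ancestor of \<open>v\<close> the letter is moved by a transposition, and the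
  parity condition is restored at a child off the path. The section at \<open>v\<close> therefore
  stays free.\<close>

lemma parity_transitive:
  assumes "length v = length w" "s \<in> parity_auts"
  shows "\<exists>g\<in>parity_auts. g v = w \<and> tree_section g v = s"
  using assms(1)
proof (induction v w rule: list_induct2)
  case Nil
  then show ?case
    using assms(2) tree_aut_Nil[OF parity_tree_aut] section_Nil[OF parity_tree_aut] by blast
next
  case (Cons x v y w)
  then obtain g where g: "g \<in> parity_auts" "g v = w" "tree_section g v = s" by blast
  obtain x' z where d: "x \<noteq> x'" "x \<noteq> z" "x' \<noteq> z" by (cases x; metis letter.distinct)
  define \<tau> where "\<tau> = Transposition.transpose x y"
  \<comment> \<open>The factor \<open>c\<close>, placed at the letter \<open>x'\<close> off the
    path, absorbs the discrepancy between the sign of \<open>\<tau>\<close> and that of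
    \<open>g\<close>.\<close>
  define c where "c = (if sign \<tau> = root_sign g then id else gen L1)"
  define f where "f = (\<lambda>u. if u = x then g else if u = x' then c else id)"
  have "sign \<tau> = 1 \<or> sign \<tau> = - 1" by (cases \<tau> rule: sign_cases) simp_all
  then have c: "c \<in> parity_auts" "root_sign g * root_sign c = sign \<tau>"
    using root_sign_cases[of g] unfolding c_def
    by (simp_all only: parity_id gen_parity split: if_split) auto
  have f: "f u \<in> parity_auts" for u using g c parity_id by (simp add: f_def)
  have "(\<Prod>u\<in>UNIV. root_sign (f u)) = sign \<tau>"
    using d c(2) by (simp add: distinct_letters_UNIV[OF d] f_def)
  then have "wreath \<tau> f \<in> parity_auts"
    by (intro parity_wreath f) (simp_all add: \<tau>_def)
  moreover have "wreath \<tau> f (x # v) = y # w" by (simp add: f_def g \<tau>_def)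
  moreover have "tree_section (wreath \<tau> f) (x # v) = s"
    using section_wreath[of f \<tau> x v, OF parity_tree_aut[OF f]] by (simp add: f_def g)
  ultimately show ?case by blast
qed

text \<open>Closed normal subgroups in terms of composition, \<open>ginv\<close> and
  \<open>agree\<close>; closedness appears as containing every element that is approximated on all
  levels.\<close>

locale closed_normal_parity =
  fixes N :: "(vertex \<Rightarrow> vertex) set"
  assumes subset: "N \<subseteq> parity_auts"
    and one: "id \<in> N"
    and comp: "g \<in> N \<Longrightarrow> h \<in> N \<Longrightarrow> g \<circ> h \<in> N"
    and ginv: "g \<in> N \<Longrightarrow> ginv g \<in> N"
    and conj: "g \<in> N \<Longrightarrow> h \<in> parity_auts \<Longrightarrow> h \<circ> g \<circ> ginv h \<in> N"
    and closed: "g \<in> parity_auts \<Longrightarrow> (\<And>n. \<exists>h\<in>N. agree n g h) \<Longrightarrow> g \<in> N"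
begin

lemma commutator:
  assumes "g \<in> N" "h \<in> parity_auts"
  shows "h \<circ> (g \<circ> ginv h \<circ> ginv g) \<in> N" "g \<circ> (h \<circ> ginv g \<circ> ginv h) \<in> N"
  using comp[OF conj[OF assms] ginv[OF assms(1)]] comp[OF assms(1) conj[OF ginv[OF assms(1)] assms(2)]]
  by (simp_all only: comp_assoc)

text \<open>The conjugate \<open>y\<close> of \<open>ginv K\<close> lives below \<open>g v\<close>,
  a different vertex of the same level, so it commutes with \<open>L\<close>. Hence [K y, L] =
  [K, L], while \<open>K \<circ> y\<close> is the commutator of \<open>K\<close> and
  \<open>g\<close> and lies in \<open>N\<close>.\<close>

lemma graft_commutator:
  assumes g: "g \<in> N" "g v \<noteq> v"
    and k: "k \<in> parity_auts" "root_sign k = 1" and l: "l \<in> parity_auts" "root_sign l = 1"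
  shows "graft v (k \<circ> l \<circ> ginv k \<circ> ginv l) \<in> N"
proof -
  define K where "K = graft v k"
  define L where "L = graft v l"
  define y where "y = g \<circ> ginv K \<circ> ginv g"
  have gt: "g \<in> tree_aut" using g(1) subset parity_tree_aut by blast
  have kt: "k \<in> tree_aut" and lt: "l \<in> tree_aut" using k l by (auto simp: parity_tree_aut)
  have KL: "K \<in> parity_auts" "L \<in> parity_auts"
    using graft_parity k l unfolding K_def L_def by blast+
  have Kt: "K \<in> tree_aut" and Lt: "L \<in> tree_aut" using KL by (auto simp: parity_tree_aut)
  have yt: "y \<in> tree_aut" unfolding y_def by (intro tree_aut_comp tree_aut_inv gt Kt)
  have "y \<circ> L = L \<circ> y"
    unfolding y_def K_def L_def ginv_graft[OF kt] graft_conj[OF gt]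
    by (rule graft_commute) (use g(2) tree_aut_length[OF gt] in simp_all)
  then have yL: "y \<circ> L \<circ> ginv y = L"
    by (simp only: comp_assoc tree_aut_ginv[OF yt] comp_id)
  have "K \<circ> y \<in> N"
    using commutator(1)[OF g(1) KL(1)] unfolding y_def by (simp only: comp_assoc)
  then have "(K \<circ> y) \<circ> (L \<circ> ginv (K \<circ> y) \<circ> ginv L) \<in> N"
    by (rule commutator(2)) (rule KL)
  also have "(K \<circ> y) \<circ> (L \<circ> ginv (K \<circ> y) \<circ> ginv L) = K \<circ> (y \<circ> L \<circ> ginv y) \<circ> ginv K \<circ> ginv L"
    unfolding ginv_comp[OF Kt yt] by (simp only: comp_assoc)
  also have "\<dots> = graft v (k \<circ> l \<circ> ginv k \<circ> ginv l)"
    unfolding yL unfolding graft_comp ginv_graft[OF kt, symmetric] ginv_graft[OF lt, symmetric] K_def L_def ..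
  finally show ?thesis .
qed

text \<open>The compensating inverses at \<open>L2\<close> and \<open>L3\<close> make both sign
  products equal to 1 even for odd \<open>x\<close> and \<open>y\<close>. As they sit at different
  letters, the commutator survives only at \<open>L1\<close>.\<close>

lemma graft_child_commutator:
  assumes g: "g \<in> N" "g v \<noteq> v"
    and x: "x \<in> parity_auts" and y: "y \<in> parity_auts"
  shows "graft (v @ [L1]) (x \<circ> y \<circ> ginv x \<circ> ginv y) \<in> N"
proof -
  define f where "f = (\<lambda>i. case i of L1 \<Rightarrow> x | L2 \<Rightarrow> ginv x | L3 \<Rightarrow> id)"
  define h where "h = (\<lambda>i. case i of L1 \<Rightarrow> y | L2 \<Rightarrow> id | L3 \<Rightarrow> ginv y)"
  have xt: "x \<in> tree_aut" and yt: "y \<in> tree_aut" using x y by (auto simp: parity_tree_aut)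
  have f: "f i \<in> parity_auts" for i
    unfolding f_def by (cases i) (simp_all only: letter.case x parity_ginv parity_id)
  have h: "h i \<in> parity_auts" for i
    unfolding h_def by (cases i) (simp_all only: letter.case y parity_ginv parity_id)
  have sf: "(\<Prod>i\<in>UNIV. root_sign (f i)) = 1" and sh: "(\<Prod>i\<in>UNIV. root_sign (h i)) = 1"
    using root_sign_cases[of x] root_sign_cases[of y]
    by (auto simp: UNIV_letter f_def h_def root_sign_ginv[OF xt] root_sign_ginv[OF yt])
  have "graft v (wreath id f \<circ> wreath id h \<circ> ginv (wreath id f) \<circ> ginv (wreath id h)) \<in> N"
    by (intro graft_commutator[OF g] parity_wreath f h bij_id) (simp_all add: sf sh)
  also have "wreath id f \<circ> wreath id h \<circ> ginv (wreath id f) \<circ> ginv (wreath id h) = graft [L1] (x \<circ> y \<circ> ginv x \<circ> ginv y)"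
    unfolding ginv_wreath_id[OF parity_tree_aut[OF f]] ginv_wreath_id[OF parity_tree_aut[OF h]] wreath_id_comp graft_simps
  proof (rule wreath_cong)
    fix i
    show "f i \<circ> h i \<circ> ginv (f i) \<circ> ginv (h i) = (if i = L1 then x \<circ> y \<circ> ginv x \<circ> ginv y else id)"
      unfolding f_def h_def using xt yt
      by (cases i) (simp_all add: ginv_ginv)
  qed simp
  finally show ?thesis unfolding graft_append .
qed

lemma graft_mem:
  assumes g: "g \<in> N" "g v \<noteq> v" and w: "length w = Suc (length v)"
    and k: "k \<in> parity_auts" "root_sign k = 1"
  shows "graft w k \<in> N"
proof -
  let ?v = "v @ [L1]"
  define Q where "Q = {m. graft ?v m \<in> N}"
  have "even_closed Q"
    unfolding even_closed_def Q_def mem_Collect_eq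
  proof (intro conjI allI ballI)
    show "graft ?v id \<in> N" unfolding graft_id by (rule one)
    show "graft ?v (m \<circ> m') \<in> N" if "m \<in> {m. graft ?v m \<in> N}" "m' \<in> {m. graft ?v m \<in> N}" for m m'
      using that unfolding graft_comp mem_Collect_eq by (rule comp)
    show "graft ?v (gen s \<circ> m \<circ> gen s) \<in> N" if m: "m \<in> {m. graft ?v m \<in> N}" for m s
    proof -
      \<comment> \<open>Some element of the group fixes the vertex and has section
        \<open>gen s\<close> there, so normality of \<open>N\<close> gives conjugation by
        \<open>gen s\<close> below it.\<close>
      obtain h where h: "h \<in> parity_auts" "h ?v = ?v" "tree_section h ?v = gen s"
        using parity_transitive[OF refl gen_parity, of ?v s] by blast
      have "h \<circ> graft ?v m \<circ> ginv h \<in> N" using m h(1) by (intro conj) simp_all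
      then show ?thesis
        unfolding graft_conj[OF parity_tree_aut[OF h(1)]] h(2,3) ginv_gen .
    qed
    show "graft ?v (gen s \<circ> gen t \<circ> gen s \<circ> gen t) \<in> N" for s t
      using graft_child_commutator[OF g gen_parity gen_parity, of s t] unfolding ginv_gen .
  qed
  have "graft ?v k \<in> N"
  proof (rule closed)
    show "graft ?v k \<in> parity_auts" using graft_parity[OF k] by blast
    show "\<exists>h\<in>N. agree n (graft ?v k) h" for n
      using even_closed_dense[OF \<open>even_closed Q\<close> k, of n] agree_graft unfolding Q_def by blast
  qed
  \<comment> \<open>A transporting element with trivial section at the starting vertex carries
    \<open>k\<close> to \<open>w\<close> unchanged.\<close>
  moreover obtain h where h: "h \<in> parity_auts" "h ?v = w" "tree_section h ?v = id"
    using parity_transitive[OF _ parity_id, of ?v w] w by auto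
  ultimately have "h \<circ> graft ?v k \<circ> ginv h \<in> N" by (intro conj)
  also have "h \<circ> graft ?v k \<circ> ginv h = graft w k"
    unfolding graft_conj[OF parity_tree_aut[OF h(1)]] h(2,3) by simp
  finally show ?thesis .
qed

text \<open>Splitting \<open>k\<close> into its sections goes down one level at a time until the
  level of \<open>graft_mem\<close> is reached. The hypothesis uses \<open>Suc j\<close> because
  sections on that level must still act trivially on their own first level, which gives sign
  1.\<close>

lemma graft_level_stab_mem:
  assumes g: "g \<in> N" "g v \<noteq> v" and "length u + j = Suc (length v)"
    and "k \<in> parity_auts" "agree (Suc j) k id"
  shows "graft u k \<in> N"
  using assms(3-5)
proof (induction j arbitrary: u k)
  case 0
  have "root_sign k = 1"
    using root_sign_agree[OF 0(3)] unfolding root_sign_id .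
  with 0(1,2) show ?case by (intro graft_mem[OF g]) simp_all
next
  case (Suc j)
  define f where "f = (\<lambda>x. tree_section k [x])"
  have kt: "k \<in> tree_aut" using Suc.prems(2) by (rule parity_tree_aut)
  have "root_perm k x = x" for x
    using Suc.prems(3) unfolding root_perm_def agree_def by simp
  then have "root_perm k = id" by (simp add: fun_eq_iff)
  then have k: "k = wreath id f"
    using wreath_decomp[OF kt] unfolding f_def by simp
  have "agree (length [x] + Suc j) k id" for x :: letter
    using Suc.prems(3) by (simp only: list.size add_0_left add_0_right add_Suc add_Suc_right)
  then have agree: "agree (Suc j) (f x) id" for x
    using section_agree[of "[x]" "Suc j" k id] unfolding f_def section_id by blast
  have parity: "f x \<in> parity_auts" for x unfolding f_def by (rule parity_section[OF Suc.prems(2)])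
  have "graft (u @ [x]) (f x) \<in> N" for x
    by (rule Suc.IH[OF _ parity agree]) (use Suc.prems(1) in simp)
  then have "graft u (graft [x] (f x)) \<in> N" for x unfolding graft_append .
  then show ?case
    unfolding k wreath_id_graft graft_comp by (intro comp)
qed

lemma level_stab_mem:
  assumes "N \<noteq> {id}"
  shows "\<exists>n. \<forall>k\<in>parity_auts. agree n k id \<longrightarrow> k \<in> N"
proof -
  obtain g where g: "g \<in> N" "g \<noteq> id" using assms one by blast
  then obtain v where v: "g v \<noteq> v" by (metis eq_id_iff)
  have "k \<in> N" if "k \<in> parity_auts" "agree (Suc (Suc (length v))) k id" for k
    using graft_level_stab_mem[OF g(1) v, of "[]" "Suc (length v)"] that by simp
  then show ?thesis by blast
qed

end

section \<open>Infinitude, topological group structure and finite index\<close>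

lemma infinite_parity_auts: "infinite parity_auts"
proof
  assume fin: "finite parity_auts"
  define K where "K = {k \<in> parity_auts. root_sign k = 1}"
  \<comment> \<open>If \<open>K\<close> were finite, the injective self-map
    \<open>graft [L1]\<close> would be onto; but its images fix the first level, while
    \<open>gen L1 \<circ> gen L2\<close> moves \<open>L1\<close>.\<close>
  have "graft [L1] ` K = K"
  proof (rule endo_inj_surj)
    show "finite K" using fin by (simp add: K_def)
    show "graft [L1] ` K \<subseteq> K" using graft_parity unfolding K_def by blast
    show "inj_on (graft [L1]) K"
    proof (rule inj_onI)
      fix k l assume "graft [L1] k = graft [L1] l"
      then have "graft [L1] k (L1 # w) = graft [L1] l (L1 # w)" for w by simp
      then show "k = l" by (simp add: fun_eq_iff)
    qed
  qed
  moreover have "gen L1 \<circ> gen L2 \<in> K"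
    by (auto simp: K_def root_sign_comp gen_tree_aut intro!: parity_comp gen_parity)
  ultimately obtain k where "gen L1 \<circ> gen L2 = graft [L1] k" by (metis imageE)
  then have "root_perm (gen L1 \<circ> gen L2) = root_perm (graft [L1] k)" by simp
  then have "root_perm (gen L1 \<circ> gen L2) L1 = L1" by simp
  then show False by (simp add: root_perm_comp[OF gen_tree_aut gen_tree_aut])
qed

text \<open>Automorphisms preserve length, so agreement of the arguments up to level
  \<open>n\<close> gives agreement of products and inverses up to the same level.\<close>

lemma topological_group_parity:
  "topological_group (AutT\<lparr>carrier := parity_auts\<rparr>) (subtopology AutT_topology parity_auts)"
proof -
  let ?G = "AutT\<lparr>carrier := parity_auts\<rparr>" and ?X = "subtopology AutT_topology parity_auts"
  interpret AutT: group AutT by (rule group_AutT)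
  interpret G: group ?G
    by (rule subgroup.subgroup_is_group[OF parity_subgroup group_AutT])
  have inv: "inv\<^bsub>?G\<^esub> g = ginv g" if "g \<in> parity_auts" for g
    using that by (intro G.inv_equality) (simp_all add: parity_tree_aut parity_ginv)
  have top: "topspace ?X = parity_auts"
    using parity_subset by (auto simp: topspace_AutT_topology)
  note opn = openin_subtopology_AutT_iff[OF parity_subset]
  have ball: "openin ?X {h \<in> parity_auts. agree n g h}" for n g
    unfolding opn by (auto intro: agree_trans)
  have "continuous_map (prod_topology ?X ?X) ?X (\<lambda>(x, y). x \<otimes>\<^bsub>?G\<^esub> y)"
    unfolding continuous_map_def topspace_prod_topology top
  proof (intro conjI allI impI)
    show "(\<lambda>(x, y). x \<otimes>\<^bsub>?G\<^esub> y) \<in> parity_auts \<times> parity_auts \<rightarrow> parity_auts"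
      by (auto simp: parity_comp simp del: comp_apply)
    fix U assume U: "openin ?X U"
    show "openin (prod_topology ?X ?X) {x \<in> parity_auts \<times> parity_auts. (case x of (x, y) \<Rightarrow> x \<otimes>\<^bsub>?G\<^esub> y) \<in> U}"
      unfolding openin_prod_topology_alt
    proof (intro allI impI)
      fix x y assume "(x, y) \<in> {x \<in> parity_auts \<times> parity_auts. (case x of (x, y) \<Rightarrow> x \<otimes>\<^bsub>?G\<^esub> y) \<in> U}"
      then have xy: "x \<in> parity_auts" "y \<in> parity_auts" "x \<circ> y \<in> U" by simp_all
      then obtain n where n: "\<And>h. h \<in> parity_auts \<Longrightarrow> agree n (x \<circ> y) h \<Longrightarrow> h \<in> U"
        using U unfolding opn by blast
      let ?A = "{h \<in> parity_auts. agree n x h}" and ?B = "{h \<in> parity_auts. agree n y h}"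
      have "x' \<circ> y' \<in> U" if "x' \<in> ?A" "y' \<in> ?B" for x' y'
        using that by (intro n parity_comp agree_comp) (simp_all add: parity_tree_aut)
      then have "?A \<times> ?B \<subseteq> {x \<in> parity_auts \<times> parity_auts. (case x of (x, y) \<Rightarrow> x \<otimes>\<^bsub>?G\<^esub> y) \<in> U}"
        by auto
      moreover have "x \<in> ?A" "y \<in> ?B" using xy by (simp_all add: agree_refl)
      ultimately show "\<exists>V W. openin ?X V \<and> openin ?X W \<and> x \<in> V \<and> y \<in> W \<and>
        V \<times> W \<subseteq> {x \<in> parity_auts \<times> parity_auts. (case x of (x, y) \<Rightarrow> x \<otimes>\<^bsub>?G\<^esub> y) \<in> U}"
        using ball by blast
    qed
  qed
  moreover have "continuous_map ?X ?X (\<lambda>x. inv\<^bsub>?G\<^esub> x)"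
    unfolding continuous_map_def top
  proof (intro conjI allI impI)
    show "(\<lambda>x. inv\<^bsub>?G\<^esub> x) \<in> parity_auts \<rightarrow> parity_auts"
      by (auto simp: inv parity_ginv)
    fix U assume U: "openin ?X U"
    show "openin ?X {x \<in> parity_auts. inv\<^bsub>?G\<^esub> x \<in> U}"
      unfolding opn
    proof (intro conjI ballI)
      fix x assume "x \<in> {x \<in> parity_auts. inv\<^bsub>?G\<^esub> x \<in> U}"
      then have x: "x \<in> parity_auts" "ginv x \<in> U" by (auto simp: inv)
      then obtain n where n: "\<And>h. h \<in> parity_auts \<Longrightarrow> agree n (ginv x) h \<Longrightarrow> h \<in> U"
        using U unfolding opn by blast
      have "ginv y \<in> U" if "y \<in> parity_auts" "agree n x y" for y
        using that x by (intro n parity_ginv agree_ginv) (simp_all add: parity_tree_aut)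
      then show "\<exists>n. \<forall>h\<in>parity_auts. agree n x h \<longrightarrow> h \<in> {x \<in> parity_auts. inv\<^bsub>?G\<^esub> x \<in> U}"
        by (auto simp: inv)
    qed auto
  qed
  moreover have "topspace ?X = carrier ?G" using top by simp
  ultimately show ?thesis
    unfolding topological_group_def using G.group_axioms by blast
qed

lemma closed_normal_parityI:
  assumes N: "N \<lhd> AutT\<lparr>carrier := parity_auts\<rparr>"
    and closed: "closedin (subtopology AutT_topology parity_auts) N"
  shows "closed_normal_parity N"
proof -
  let ?G = "AutT\<lparr>carrier := parity_auts\<rparr>"
  interpret G: group ?G
    by (rule subgroup.subgroup_is_group[OF parity_subgroup group_AutT])
  have inv: "inv\<^bsub>?G\<^esub> g = ginv g" if "g \<in> parity_auts" for g
    using that by (intro G.inv_equality) (simp_all add: parity_tree_aut parity_ginv)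
  interpret N: normal N ?G by (rule N)
  have sub: "N \<subseteq> parity_auts" using N.subset by simp
  show ?thesis
  proof
    show "N \<subseteq> parity_auts" by (rule sub)
    show "id \<in> N" using N.one_closed by (simp only: monoid.simps AutT_def partial_object.simps)
    show "g \<circ> h \<in> N" if "g \<in> N" "h \<in> N" for g h
      using N.m_closed[OF that] by (simp only: monoid.simps AutT_def partial_object.simps)
    show "ginv g \<in> N" if "g \<in> N" for g
      using N.m_inv_closed[OF that] inv[OF subsetD[OF sub that]] by metis
    show "h \<circ> g \<circ> ginv h \<in> N" if "g \<in> N" "h \<in> parity_auts" for g h
      using N.inv_op_closed2[of h g] that inv[OF that(2)] by (simp add: AutT_def)
    fix g assume g: "g \<in> parity_auts" "\<And>n. \<exists>h\<in>N. agree n g h"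
    show "g \<in> N"
    proof (rule ccontr)
      assume "g \<notin> N"
      have "topspace (subtopology AutT_topology parity_auts) = parity_auts"
        using parity_subset by (auto simp: topspace_AutT_topology)
      then have "openin (subtopology AutT_topology parity_auts) (parity_auts - N)"
        using closed unfolding closedin_def by simp
      then obtain n where "\<forall>h\<in>parity_auts. agree n g h \<longrightarrow> h \<in> parity_auts - N"
        using g(1) \<open>g \<notin> N\<close> unfolding openin_subtopology_AutT_iff[OF parity_subset] by blast
      with g(2)[of n] sub show False by blast
    qed
  qed
qed

text \<open>A coset of \<open>N\<close> is determined by the restriction of any representative to
  words of length at most \<open>n\<close>, and only finitely many restrictions exist.\<close>

lemma finite_rcosets_parity:
  assumes "N \<lhd> AutT\<lparr>carrier := parity_auts\<rparr>"
    and n: "\<And>k. k \<in> parity_auts \<Longrightarrow> agree n k id \<Longrightarrow> k \<in> N"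
  shows "finite (rcosets\<^bsub>AutT\<lparr>carrier := parity_auts\<rparr>\<^esub> N)"
proof -
  let ?G = "AutT\<lparr>carrier := parity_auts\<rparr>"
  interpret G: group ?G
    by (rule subgroup.subgroup_is_group[OF parity_subgroup group_AutT])
  interpret N: normal N ?G by (rule assms(1))
  define W where "W = {w :: vertex. length w \<le> n}"
  define r where "r = (\<lambda>g :: vertex \<Rightarrow> vertex. restrict g W)"
  have "finite W"
    using finite_lists_length_le[of "UNIV :: letter set" n] by (simp add: W_def)
  moreover have "r ` parity_auts \<subseteq> W \<rightarrow>\<^sub>E W"
  proof (rule image_subsetI)
    fix g assume "g \<in> parity_auts"
    then show "r g \<in> W \<rightarrow>\<^sub>E W"
      using tree_aut_length[OF parity_tree_aut] unfolding r_def restrict_PiE_iff W_def by simp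
  qed
  ultimately have fin: "finite (r ` parity_auts)"
    by (meson finite_PiE finite_subset)
  have eq: "N #>\<^bsub>?G\<^esub> g = N #>\<^bsub>?G\<^esub> h" if gh: "g \<in> parity_auts" "h \<in> parity_auts" "r g = r h" for g h
  proof -
    have "g w = h w" if "length w \<le> n" for w
      using fun_cong[OF gh(3), of w] that by (simp add: r_def W_def)
    then have "agree n g h" by (simp add: agree_def)
    then have "agree n (g \<circ> ginv h) (h \<circ> ginv h)"
      using gh by (intro agree_comp agree_refl) (simp_all add: tree_aut_inv parity_tree_aut)
    then have "g \<circ> ginv h \<in> N"
      using gh by (intro n parity_comp parity_ginv) (simp_all add: parity_tree_aut)
    moreover have "g = (g \<circ> ginv h) \<circ> h"
      using gh by (simp only: comp_assoc tree_aut_ginv parity_tree_aut comp_id)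
    ultimately have "g \<in> N #>\<^bsub>?G\<^esub> h"
      unfolding r_coset_def by (auto simp only: partial_object.simps monoid.simps AutT_def intro!: UN_I)
    then show ?thesis
      using G.repr_independence[of g N h] gh(2) N.subgroup_axioms by simp
  qed
  \<comment> \<open>One representative is chosen for each restriction, so all cosets come from a
    finite set.\<close>
  have "(\<lambda>g. N #>\<^bsub>?G\<^esub> g) ` parity_auts \<subseteq> (\<lambda>s. N #>\<^bsub>?G\<^esub> inv_into parity_auts r s) ` r ` parity_auts"
  proof
    fix C assume "C \<in> (\<lambda>g. N #>\<^bsub>?G\<^esub> g) ` parity_auts"
    then obtain g where g: "g \<in> parity_auts" "C = N #>\<^bsub>?G\<^esub> g" by blast
    have "C = N #>\<^bsub>?G\<^esub> inv_into parity_auts r (r g)"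
      unfolding g(2) using g(1)
      by (intro eq) (simp_all add: inv_into_into f_inv_into_f)
    with g(1) show "C \<in> (\<lambda>s. N #>\<^bsub>?G\<^esub> inv_into parity_auts r s) ` r ` parity_auts" by blast
  qed
  moreover have "rcosets\<^bsub>?G\<^esub> N = (\<lambda>g. N #>\<^bsub>?G\<^esub> g) ` parity_auts"
    by (auto simp: RCOSETS_def)
  ultimately show ?thesis
    using fin by (simp add: finite_subset)
qed

theorem corollary4:
  shows "just_infinite (AutT\<lparr>carrier := hanoi_closure\<rparr>) (subtopology AutT_topology hanoi_closure)"
  unfolding just_infinite_def hanoi_closure_eq
proof (intro conjI allI impI)
  let ?G = "AutT\<lparr>carrier := parity_auts\<rparr>" and ?X = "subtopology AutT_topology parity_auts"
  show "topological_group ?G ?X" by (rule topological_group_parity)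
  show "infinite (carrier ?G)" using infinite_parity_auts by simp
  fix N assume N: "N \<lhd> ?G \<and> closedin ?X N \<and> N \<noteq> {\<one>\<^bsub>?G\<^esub>}"
  then interpret closed_normal_parity N by (intro closed_normal_parityI) simp_all
  have "N \<noteq> {id}" using N by (simp add: AutT_def)
  then obtain n where "\<And>k. k \<in> parity_auts \<Longrightarrow> agree n k id \<Longrightarrow> k \<in> N"
    using level_stab_mem by blast
  then show "finite (rcosets\<^bsub>?G\<^esub> N)"
    using N by (intro finite_rcosets_parity) simp_all
qed

end
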